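(* Let $P(u)=\sum_{i=-c}^{d}p_i u^i$ be the Laurent polynomial encoding the jumps allowed at each step of a walk, where $p_i$ is the weight of the jump $i$. Let $w_{n,k,j}$ be the number of walks of length $n$ which end at altitude $k$, and have $j$ crossings of the $x$-axis. Then the generating function $$W(z,u,q)=\sum_{n,j\ge 0,\;k\in\mathbb{Z}} w_{n,k,j}\,z^n u^k q^j=\sum_{k\in\mathbb{Z}}W_k(z,q)\,u^k$$ is algebraic and expressible in terms of the roots $u_i(z)$ of $1-zP(u)=0$.
   Context: A walk of length $n$ is a directed lattice path on $\mathbb{Z}$ given by its successive altitudes $(y_0,y_1,\dots,y_n)$, with $y_0=0$, each jump $y_{t+1}-y_t$ being one of the finitely many allowed jumps $i\in\{-c,\dots,d\}$ encoded by the Laurent polynomial $P(u)$; the altitudes are unconstrained (they may be negative). In the basic case $P(u)=1/u^c+\dots+u^d$ is the sum of $u^i$ over the allowed jumps $i$; more generally each jump $i$ may get a weight $p_i$, in which case each walk is counted with the product of the weights of its jumps. The number of crossings of the $x$-axis of the walk is $\#\{0<t<n : (y_t>0 \text{ and } y_{t+1}<0)\text{ or }(y_t<0\text{ and }y_{t+1}>0)\}$, i.e. the number of steps which cross the $x$-axis without starting or ending at altitude $0$. The roots of $1-zP(u)=0$ are the solutions $u=u(z)$ of this equation, as Puiseux series in $z$: there are $c$ small roots (tending to $0$ as $z\to 0$) and $d$ large roots (whose modulus tends to infinity as $z\to0$). *)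

theory Defs
  imports "HOL-Computational_Algebra.Computational_Algebra"
begin

text \<open>Walks are lists of altitudes. The weight function \<open>p\<close> is only used on \<open>{-c..d}\<close>; a jump of this
  interval which is not allowed is a jump of weight 0, and weight 1 on every allowed jump
  gives the plain number of walks.\<close>

definition walks :: "nat \<Rightarrow> nat \<Rightarrow> nat \<Rightarrow> int list set" where
  "walks c d n = {y. length y = n + 1 \<and> y ! 0 = 0 \<and>
     (\<forall>t<n. y ! (t + 1) - y ! t \<in> {- int c..int d})}"

definition crossings :: "nat \<Rightarrow> int list \<Rightarrow> nat" where
  "crossings n y = card {t. 0 < t \<and> t < n \<and>
     (y ! t > 0 \<and> y ! (t + 1) < 0 \<or> y ! t < 0 \<and> y ! (t + 1) > 0)}"

definition walk_weight :: "(int \<Rightarrow> 'a::comm_ring_1) \<Rightarrow> nat \<Rightarrow> int list \<Rightarrow> 'a" where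
  "walk_weight p n y = (\<Prod>t<n. p (y ! (t + 1) - y ! t))"

definition num_walks ::
    "(int \<Rightarrow> 'a::comm_ring_1) \<Rightarrow> nat \<Rightarrow> nat \<Rightarrow> nat \<Rightarrow> int \<Rightarrow> nat \<Rightarrow> 'a" where
  "num_walks p c d n k j =
     (\<Sum>y | y \<in> walks c d n \<and> y ! n = k \<and> crossings n y = j. walk_weight p n y)"

lemma finite_walks: "finite (walks c d n)"
proof (rule finite_subset)
  show "walks c d n \<subseteq>
      {y. set y \<subseteq> {- int (n * c)..int (n * d)} \<and> length y = n + 1}"
  proof
    fix y assume y: "y \<in> walks c d n"
    have b: "- int (t * c) \<le> y ! t \<and> y ! t \<le> int (t * d)" if "t \<le> n" for t
      using that
    proof (induction t)
      case 0
      then show ?case using y by (simp add: walks_def)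
    next
      case (Suc t)
      have "y ! (t + 1) - y ! t \<in> {- int c..int d}"
        using y Suc.prems by (simp add: walks_def)
      then show ?case using Suc by (simp add: algebra_simps)
    qed
    have "- int (n * c) \<le> y ! t \<and> y ! t \<le> int (n * d)" if "t \<le> n" for t
    proof -
      have "int (t * c) \<le> int (n * c)" "int (t * d) \<le> int (n * d)"
        using that by (simp_all only: of_nat_le_iff mult_le_mono1)
      then show ?thesis using b[OF that] by linarith
    qed
    then show "y \<in> {y. set y \<subseteq> {- int (n * c)..int (n * d)} \<and> length y = n + 1}"
      using y by (auto simp: walks_def in_set_conv_nth)
  qed
qed (simp add: finite_lists_length_eq)

text \<open>The coefficients of the powers of \<open>z\<close> lie in \<open>K[u,1/u,q]\<close>, which is viewed as a subring of the
  rational function field \<open>K(u,q)\<close>, constructed as the fraction field of \<open>K[u][q]\<close>.\<close>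

type_synonym 'a ratfun_uq = "'a poly poly fract"

definition const_uq :: "'a::field \<Rightarrow> 'a ratfun_uq" where
  "const_uq a = to_fract [:[:a:]:]"

definition var_u :: "'a::field ratfun_uq" where
  "var_u = to_fract [:[:0, 1:]:]"

definition var_q :: "'a::field ratfun_uq" where
  "var_q = to_fract [:0, 1:]"

text \<open>A walk of length \<open>n\<close> ends in \<open>{-n*c..n*d}\<close> and has at most \<open>n\<close> crossings, so the ranges
  below omit only zero terms of the sum over all integers \<open>k\<close> and all \<open>j \<ge> 0\<close>.\<close>

definition walk_gf :: "(int \<Rightarrow> 'a::field) \<Rightarrow> nat \<Rightarrow> nat \<Rightarrow> 'a ratfun_uq fps" where
  "walk_gf p c d = Abs_fps (\<lambda>n.
     \<Sum>k = - int (n * c)..int (n * d). \<Sum>j\<le>n.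
       const_uq (num_walks p c d n k j) * var_u powi k * var_q ^ j)"

inductive_set generated_subfield :: "'b::field set \<Rightarrow> 'b set" for S where
  base: "x \<in> S \<Longrightarrow> x \<in> generated_subfield S"
| one: "1 \<in> generated_subfield S"
| diff: "x \<in> generated_subfield S \<Longrightarrow> y \<in> generated_subfield S \<Longrightarrow>
    x - y \<in> generated_subfield S"
| mult: "x \<in> generated_subfield S \<Longrightarrow> y \<in> generated_subfield S \<Longrightarrow>
    x * y \<in> generated_subfield S"
| inverse: "x \<in> generated_subfield S \<Longrightarrow> inverse x \<in> generated_subfield S"

definition algebraic_over :: "'b::field set \<Rightarrow> 'b \<Rightarrow> bool" where
  "algebraic_over F x \<longleftrightarrow> (\<exists>Q. Q \<noteq> 0 \<and> (\<forall>i. coeff Q i \<in> F) \<and> poly Q x = 0)"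

text \<open>A Puiseux series in \<open>z\<close> over \<open>K\<close> whose exponents have denominators dividing \<open>m\<close> is a formal
  Laurent series in \<open>t\<close>, where \<open>t ^ m = z\<close>. The series below are the solutions \<open>u\<close> of
  \<open>1 - z P(u) = 0\<close> of this kind; \<open>u(z)\<close> tends to zero (infinity) as \<open>z\<close> tends to 0 if and only if
  its lowest exponent is positive (negative).\<close>

definition kernel_roots :: "(int \<Rightarrow> 'a::field) \<Rightarrow> nat \<Rightarrow> nat \<Rightarrow> nat \<Rightarrow> 'a fls set" where
  "kernel_roots p c d m =
     {r. r \<noteq> 0 \<and> 1 - fls_X ^ m * (\<Sum>i = - int c..int d. fls_const (p i) * r powi i) = 0}"

definition small_roots :: "(int \<Rightarrow> 'a::field) \<Rightarrow> nat \<Rightarrow> nat \<Rightarrow> nat \<Rightarrow> 'a fls set" where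
  "small_roots p c d m = {r \<in> kernel_roots p c d m. fls_subdegree r > 0}"

definition large_roots :: "(int \<Rightarrow> 'a::field) \<Rightarrow> nat \<Rightarrow> nat \<Rightarrow> nat \<Rightarrow> 'a fls set" where
  "large_roots p c d m = {r \<in> kernel_roots p c d m. fls_subdegree r < 0}"

text \<open>Coefficientwise inclusion of \<open>K((t))\<close> into \<open>K(u,q)((t))\<close>.\<close>

definition lift_fls :: "'a::field fls \<Rightarrow> 'a ratfun_uq fls" where
  "lift_fls f = Abs_fls (\<lambda>n. const_uq (fls_nth f n))"

text \<open>The field \<open>K(z,u,q)\<close> inside \<open>K(u,q)((t))\<close>, where \<open>z = t ^ m\<close>, and its extension by a set of
  series in \<open>t\<close>, that is, the values of the rational expressions over \<open>K\<close> in \<open>z\<close>, \<open>u\<close>, \<open>q\<close> and the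
  elements of that set.\<close>

definition field_zuq :: "nat \<Rightarrow> 'a::field ratfun_uq fls set \<Rightarrow> 'a ratfun_uq fls set" where
  "field_zuq m R = generated_subfield
     (range (\<lambda>a. fls_const (const_uq a)) \<union>
      {fls_X ^ m, fls_const var_u, fls_const var_q} \<union> R)"

end

theory Submission
  imports Defs "HOL-Algebra.Algebraic_Closure_Type"
begin

text \<open>
  Let \<open>w\<^sub>k\<close> be the series in \<open>z\<close> counting the walks that end at altitude \<open>k\<close>, with \<open>q\<close> marking the
  crossings. Looking at the last step gives a linear recurrence between the \<open>w\<^sub>k\<close>. Summed over \<open>k\<close> it
  reads \<open>(1 - z P(u)) W = 1 + z (q - 1) C\<close>, where \<open>C\<close> collects the steps that cross the axis and
  therefore involves only the \<open>w\<^sub>k\<close> with \<open>-d \<le> k \<le> c\<close> (\<open>walk_gf_functional_equation\<close>). It remains to see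
  that these finitely many series are rational expressions in \<open>z\<close>, \<open>q\<close> and the roots of the kernel.

  Away from the axis the recurrence has constant coefficients, and the kernel method applies on each
  half-line separately. For \<open>k > 0\<close> let the kernel \<open>u^c (1 - z P(u))\<close> be written as \<open>T(u) \<kappa>(u)\<close>, where \<open>T\<close> is
  the product of the \<open>u - u\<^sub>i\<close> over the small roots, and let \<open>W\<^sub>+\<close> be the part of \<open>W\<close> with positive
  powers of \<open>u\<close>. The small roots vanish at \<open>z = 0\<close>, so \<open>T\<close> is \<open>u^c\<close> up to small terms. This forces
  \<open>\<kappa> W\<^sub>+\<close> to be a polynomial in \<open>u\<close>, and its coefficients are determined by the steps arriving
  from \<open>k \<le> 0\<close> (\<open>half_line\<close>). For \<open>k < 0\<close> one reflects the walks, which exchanges small roots with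
  inverses of large ones. Every \<open>w\<^sub>k\<close> with \<open>-d \<le> k \<le> c\<close> is thereby a constant plus a linear combination
  of these same series, with coefficients that lie in the field and vanish at \<open>z = 0\<close>. Such a system
  can be solved within the field (\<open>contracting_system_solution\<close>).

  The roots themselves are explicit: \<open>u^c = z \<phi>(u)\<close> with \<open>\<phi>(0) \<noteq> 0\<close> is solved by Lagrange inversion in
  \<open>z^(1/c)\<close>, and the \<open>c\<close>-th roots of unity produce \<open>c\<close> distinct small solutions (\<open>series_solutions\<close>).
  With the \<open>d\<close> large ones this exhausts the degree of the kernel (\<open>kernel_roots_structure\<close>).

  Finally, the roots are algebraic over \<open>K(z,u,q)\<close>, hence so is every element of the field that they
  generate, and in particular \<open>W\<close>.
\<close>

section \<open>Algebraic elements over a generated field\<close>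

lemma generated_subfield_zero: "0 \<in> generated_subfield S"
  using generated_subfield.diff[OF generated_subfield.one generated_subfield.one] by simp

lemma generated_subfield_uminus: "x \<in> generated_subfield S \<Longrightarrow> - x \<in> generated_subfield S"
  using generated_subfield.diff[OF generated_subfield_zero] by simp

lemma generated_subfield_power: "x \<in> generated_subfield S \<Longrightarrow> x ^ n \<in> generated_subfield S"
  by (induction n) (auto intro: generated_subfield.intros)

lemma generated_subfield_power_int: "x \<in> generated_subfield S \<Longrightarrow> x powi n \<in> generated_subfield S"
  by (auto simp: power_int_def intro: generated_subfield_power generated_subfield.inverse)

text \<open>That algebraic elements form a field is a theorem about rings represented as records,
  whose polynomials are coefficient lists with the leading coefficient first. The lemmas up to
  \<open>algebraic_over_iff\<close> translate it to the type-class fields used here.\<close>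

lemma eval_type_algebra:
  "ring.eval (ring_of_type_algebra :: 'b::field ring) xs x = poly (Poly (rev xs)) x"
proof -
  interpret R: field "ring_of_type_algebra :: 'b ring" by rule
  have [simp]: "x [^]\<^bsub>ring_of_type_algebra\<^esub> (n::nat) = x ^ n" for n
    by (induction n) (simp_all add: ring_of_type_algebra_def nat_pow_def)
  show ?thesis
    by (induction xs)
      (simp_all add: Poly_append poly_monom, simp_all add: ring_of_type_algebra_def algebra_simps)
qed

lemma type_algebra_minus:
  "a_inv (ring_of_type_algebra :: 'b::field ring) x = - x"
proof -
  interpret R: field "ring_of_type_algebra :: 'b ring" by rule
  show ?thesis
    by (rule R.minus_equality) (simp_all add: ring_of_type_algebra_def)
qed

lemma type_algebra_inverse:
  assumes "x \<noteq> 0"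
  shows "m_inv (ring_of_type_algebra :: 'b::field ring) x = inverse x"
proof -
  interpret R: field "ring_of_type_algebra :: 'b ring" by rule
  show ?thesis
    by (rule R.comm_inv_char) (use assms in \<open>simp_all add: ring_of_type_algebra_def\<close>)
qed

lemma subfield_type_algebra:
  fixes F :: "'b::field set"
  assumes "1 \<in> F" "\<And>x y. x \<in> F \<Longrightarrow> y \<in> F \<Longrightarrow> x - y \<in> F"
    "\<And>x y. x \<in> F \<Longrightarrow> y \<in> F \<Longrightarrow> x * y \<in> F" "\<And>x. x \<in> F \<Longrightarrow> inverse x \<in> F"
  shows "subfield F (ring_of_type_algebra :: 'b ring)"
proof -
  interpret R: field "ring_of_type_algebra :: 'b ring" by rule
  have 0: "0 \<in> F" using assms(1) assms(2)[of 1 1] by simp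
  have neg: "- x \<in> F" if "x \<in> F" for x using assms(2)[OF 0 that] by simp
  have add: "x + y \<in> F" if "x \<in> F" "y \<in> F" for x y
    using assms(2)[OF that(1) neg[OF that(2)]] by simp
  show ?thesis
  proof (rule R.subfieldI', rule R.subringI)
    fix k assume "k \<in> F - {\<zero>\<^bsub>ring_of_type_algebra\<^esub>}"
    then have "k \<in> F" "k \<noteq> 0" by (auto simp: ring_of_type_algebra_def)
    then show "inv\<^bsub>ring_of_type_algebra\<^esub> k \<in> F"
      using assms(4) by (simp add: type_algebra_inverse)
  qed (use assms(1,3) neg add in \<open>simp_all add: type_algebra_minus\<close>,
       simp_all add: ring_of_type_algebra_def)
qed

lemma algebraic_over_iff:
  fixes F :: "'b::field set"
  assumes F: "subfield F (ring_of_type_algebra :: 'b ring)"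
  shows "algebraic_over F x \<longleftrightarrow>
    (ring.algebraic (ring_of_type_algebra :: 'b ring) over F) x"
proof -
  interpret R: field "ring_of_type_algebra :: 'b ring" by rule
  note sub = subfieldE(1)[OF F]
  have 0: "0 \<in> F" using subringE(2)[OF sub] by (simp add: ring_of_type_algebra_def)
  show ?thesis
  proof
    assume "algebraic_over F x"
    then obtain Q where Q: "Q \<noteq> 0" "\<And>i. Polynomial.coeff Q i \<in> F" "poly Q x = 0"
      by (auto simp: algebraic_over_def)
    have "rev (coeffs Q) \<in> carrier (univ_poly ring_of_type_algebra F)"
      using Q(1,2)
      by (auto simp: univ_poly_def polynomial_def hd_rev last_coeffs_eq_coeff_degree
            ring_of_type_algebra_def coeffs_def)
    moreover have "R.eval (rev (coeffs Q)) x = \<zero>\<^bsub>ring_of_type_algebra\<^esub>"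
      using Q(3) by (simp add: eval_type_algebra) (simp add: ring_of_type_algebra_def)
    ultimately show "(R.algebraic over F) x"
      using Q(1) by (intro R.algebraicI) auto
  next
    assume "(R.algebraic over F) x"
    moreover have "x \<in> carrier ring_of_type_algebra" by (simp add: ring_of_type_algebra_def)
    ultimately obtain xs where xs: "xs \<in> carrier (univ_poly ring_of_type_algebra F)" "xs \<noteq> []"
      "R.eval xs x = \<zero>\<^bsub>ring_of_type_algebra\<^esub>"
      using R.algebraicE[OF sub] by blast
    have hd: "hd xs \<noteq> 0" and set: "set xs \<subseteq> F"
      using xs(1,2) by (auto simp: univ_poly_def polynomial_def) (simp add: ring_of_type_algebra_def)
    have "Polynomial.coeff (Poly (rev xs)) (length xs - 1) \<noteq> 0"
      using hd xs(2) by (simp add: nth_default_def rev_nth hd_conv_nth)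
    then have "Poly (rev xs) \<noteq> 0" by (metis coeff_0)
    moreover have "Polynomial.coeff (Poly (rev xs)) i \<in> F" for i
      using set 0 by (auto simp: nth_default_def rev_nth subset_iff)
    moreover have "poly (Poly (rev xs)) x = 0"
      using xs(3) by (simp add: eval_type_algebra) (simp add: ring_of_type_algebra_def)
    ultimately show "algebraic_over F x" by (auto simp: algebraic_over_def)
  qed
qed

lemma algebraic_over_generated_closed:
  fixes T :: "'b::field set"
  assumes x: "algebraic_over (generated_subfield T) x" and y: "algebraic_over (generated_subfield T) y"
  shows "algebraic_over (generated_subfield T) (x - y)"
    "algebraic_over (generated_subfield T) (x * y)"
    "algebraic_over (generated_subfield T) (inverse x)"
proof -
  interpret R: field "ring_of_type_algebra :: 'b ring" by rule
  let ?F = "generated_subfield T"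
  have F: "subfield ?F (ring_of_type_algebra :: 'b ring)"
    by (rule subfield_type_algebra; (rule generated_subfield.intros; assumption?))
  define E where "E = {x. algebraic_over ?F x}"
  have "{x \<in> carrier ring_of_type_algebra. (R.algebraic over ?F) x} = E"
    by (auto simp: E_def algebraic_over_iff[OF F] ring_of_type_algebra_def)
  then have E: "subfield E ring_of_type_algebra"
    using R.subfield_of_algebraics[OF F] by simp
  note sub = subfieldE(1)[OF E]
  have xy: "x \<in> E" "y \<in> E" using x y by (auto simp: E_def)
  have "x - y \<in> E"
    using subringE(7)[OF sub xy(1) subringE(5)[OF sub xy(2)]]
    by (simp add: type_algebra_minus) (simp add: ring_of_type_algebra_def)
  moreover have "x * y \<in> E"
    using subringE(6)[OF sub xy] by (simp add: ring_of_type_algebra_def)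
  moreover have "inverse x \<in> E"
  proof (cases "x = 0")
    case False
    then show ?thesis
      using R.subfield_m_inv(1)[OF E, of x] xy
      by (simp add: type_algebra_inverse) (simp add: ring_of_type_algebra_def)
  qed (use xy in simp)
  ultimately show "algebraic_over ?F (x - y)" "algebraic_over ?F (x * y)" "algebraic_over ?F (inverse x)"
    by (auto simp: E_def)
qed

lemma algebraic_over_self:
  assumes "x \<in> generated_subfield T"
  shows "algebraic_over (generated_subfield T) x"
  unfolding algebraic_over_def
  by (rule exI[of _ "[:- x, 1:]"])
    (use assms in \<open>auto simp: coeff_pCons split: nat.split
        intro: generated_subfield.one generated_subfield_zero generated_subfield_uminus\<close>)

lemma generated_subfield_algebraic:
  assumes "x \<in> generated_subfield S" "\<And>x. x \<in> S \<Longrightarrow> algebraic_over (generated_subfield T) x"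
  shows "algebraic_over (generated_subfield T) x"
  using assms(1)
proof (induction rule: generated_subfield.induct)
  case (base x)
  then show ?case by (rule assms(2))
next
  case one
  show ?case by (rule algebraic_over_self[OF generated_subfield.one])
next
  case (diff x y)
  show ?case by (rule algebraic_over_generated_closed(1)[OF diff.IH])
next
  case (mult x y)
  show ?case by (rule algebraic_over_generated_closed(2)[OF mult.IH])
next
  case (inverse x)
  show ?case by (rule algebraic_over_generated_closed(3)[OF inverse.IH inverse.IH])
qed

section \<open>The roots of the kernel\<close>

lemma prod_linear_factors_dvd:
  fixes Q :: "'b::idom poly"
  assumes "finite A" "\<And>a. a \<in> A \<Longrightarrow> poly Q a = 0"
  shows "(\<Prod>a\<in>A. [:- a, 1:]) dvd Q"
  using assms
proof (induction A rule: finite_induct)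
  case (insert a A)
  then obtain Q' where Q': "Q = (\<Prod>a\<in>A. [:- a, 1:]) * Q'" by (auto elim: dvdE)
  have "poly (\<Prod>a\<in>A. [:- a, 1:]) a \<noteq> 0"
    using insert.hyps by (auto simp: poly_prod)
  moreover have "poly Q a = 0" using insert.prems by simp
  ultimately have "poly Q' a = 0" using Q' by simp
  then have "[:- a, 1:] dvd Q'" by (simp add: poly_eq_0_iff_dvd)
  then have "[:- a, 1:] * (\<Prod>a\<in>A. [:- a, 1:]) dvd Q' * (\<Prod>a\<in>A. [:- a, 1:])"
    by (rule mult_dvd_mono) simp
  then show ?case unfolding prod.insert[OF insert.hyps] Q' by (simp only: mult.commute)
qed simp

text \<open>The derivative of \<open>X ^ c - 1\<close> vanishes at no root, so no root is double, and over an
  algebraically closed field a factor without roots is constant.\<close>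

lemma card_roots_of_unity:
  assumes "c > 0"
  shows "card {w :: 'a::{alg_closed_field, field_char_0}. w ^ c = 1} = c"
proof -
  define Q where "Q = Polynomial.monom (1::'a) c - 1"
  define R where "R = {w::'a. w ^ c = 1}"
  have poly_Q: "poly Q w = w ^ c - 1" for w by (simp add: Q_def poly_monom)
  have coeff_c: "Polynomial.coeff Q c = 1" using assms by (simp add: Q_def)
  then have Q0: "Q \<noteq> 0" by auto
  have R: "R = {w. poly Q w = 0}" by (simp add: R_def poly_Q)
  have finR: "finite R" unfolding R by (rule poly_roots_finite[OF Q0])
  define D where "D = (\<Prod>w\<in>R. [:- w, 1:])"
  have "D dvd Q" unfolding D_def by (rule prod_linear_factors_dvd[OF finR]) (simp add: R)
  then obtain S where S: "Q = D * S" by (auto elim: dvdE)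
  have "Polynomial.degree S = 0"
  proof (rule ccontr)
    assume "Polynomial.degree S \<noteq> 0"
    then obtain w where w: "poly S w = 0" using alg_closed_imp_poly_has_root[of S] by auto
    then have "w \<in> R" using S by (simp add: R)
    then have "poly D w = 0" using finR by (auto simp: D_def poly_prod)
    then have "poly (pderiv Q) w = 0" using w by (simp add: S pderiv_mult)
    moreover have "poly (pderiv Q) w = of_nat c * w ^ (c - 1)"
      by (simp add: Q_def pderiv_diff pderiv_monom poly_monom)
    moreover have "w \<noteq> 0" using \<open>w \<in> R\<close> assms by (auto simp: R_def power_0_left)
    ultimately show False using assms by simp
  qed
  moreover have "Polynomial.degree Q = c"
  proof (rule antisym)
    show "Polynomial.degree Q \<le> c"
      unfolding Q_def by (rule degree_diff_le) (simp_all add: degree_monom_le)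
    show "c \<le> Polynomial.degree Q" by (rule le_degree) (simp add: coeff_c)
  qed
  moreover have "Polynomial.degree D = card R" unfolding D_def by (subst degree_prod_eq_sum_degree) auto
  moreover have "Polynomial.degree Q = Polynomial.degree D + Polynomial.degree S"
    using Q0 S by (subst S, subst degree_mult_eq) auto
  ultimately show ?thesis by (simp add: R_def)
qed

text \<open>This is \<open>u ^ c * (1 - z * P(u))\<close> as a polynomial in \<open>u\<close>. The ring of coefficients is arbitrary,
  because the polynomial is evaluated at power series, at Laurent series, and over both \<open>K\<close> and
  \<open>K(u,q)\<close>.\<close>

definition kernel_poly :: "(int \<Rightarrow> 'b::comm_ring_1) \<Rightarrow> nat \<Rightarrow> nat \<Rightarrow> 'b \<Rightarrow> 'b poly" where
  "kernel_poly p c d z =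
     Polynomial.monom 1 c - Polynomial.smult z (\<Sum>i\<le>c+d. Polynomial.monom (p (int i - int c)) i)"

lemma coeff_kernel_poly:
  "Polynomial.coeff (kernel_poly p c d z) n =
     (if n = c then 1 else 0) - (if n \<le> c + d then z * p (int n - int c) else 0)"
  by (simp add: kernel_poly_def coeff_sum if_distrib[of "(*) z"] cong: if_cong)

lemma poly_kernel_poly:
  "poly (kernel_poly p c d z) r = r ^ c - z * (\<Sum>i\<le>c+d. p (int i - int c) * r ^ i)"
  by (simp add: kernel_poly_def poly_sum poly_monom)

lemma sum_jumps_reindex:
  "(\<Sum>i\<le>c+d. f (int i - int c)) = (\<Sum>i=-int c..int d. f i)"
  by (rule sum.reindex_bij_witness[of _ "\<lambda>i. nat (i + int c)" "\<lambda>i. int i - int c"]) auto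

lemma poly_kernel_poly_field:
  fixes r :: "'b::field"
  assumes "r \<noteq> 0"
  shows "poly (kernel_poly p c d z) r = r ^ c * (1 - z * (\<Sum>i=-int c..int d. p i * r powi i))"
proof -
  have "p (int i - int c) * r ^ i = r ^ c * (p (int i - int c) * r powi (int i - int c))" for i
    using assms by (simp add: power_int_diff field_simps)
  then have "(\<Sum>i\<le>c+d. p (int i - int c) * r ^ i) =
      r ^ c * (\<Sum>i\<le>c+d. p (int i - int c) * r powi (int i - int c))"
    by (simp only: sum_distrib_left)
  also have "(\<Sum>i\<le>c+d. p (int i - int c) * r powi (int i - int c)) =
      (\<Sum>i=-int c..int d. p i * r powi i)"
    by (rule sum_jumps_reindex)
  finally show ?thesis by (simp add: poly_kernel_poly algebra_simps)
qed

text \<open>Reflecting all walks at the origin replaces \<open>P(u)\<close> by \<open>P(1/u)\<close>. Large roots are thus the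
  inverses of the small roots of the reflected problem, and only small roots have to be
  constructed.\<close>

lemma poly_kernel_poly_inverse:
  fixes r :: "'b::field"
  assumes "r \<noteq> 0"
  shows "poly (kernel_poly p c d z) (inverse r) = 0 \<longleftrightarrow>
    poly (kernel_poly (\<lambda>i. p (- i)) d c z) r = 0"
proof -
  have "(\<Sum>i=-int c..int d. p i * inverse r powi i) = (\<Sum>i=-int d..int c. p (- i) * r powi i)"
    by (rule sum.reindex_bij_witness[of _ uminus uminus])
      (auto simp: power_int_inverse power_int_minus)
  then show ?thesis using assms by (simp add: poly_kernel_poly_field)
qed

text \<open>With \<open>\<psi> ^ c = \<phi>\<close> the equation \<open>U ^ c = X ^ c * \<phi>(U)\<close> follows from \<open>U = X * \<psi>(U)\<close>, which says that
  \<open>U\<close> is the compositional inverse of \<open>X / \<psi>\<close>. Substituting \<open>w * X ^ e\<close> for \<open>X\<close>, where \<open>w\<close> is a root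
  of unity of order dividing \<open>c\<close>, leaves the equation intact up to \<open>X ^ c\<close> becoming \<open>X ^ (c * e)\<close>. The
  coefficient of \<open>X ^ e\<close> tells the resulting solutions apart.\<close>

lemma series_solutions:
  fixes \<phi> :: "'a::{alg_closed_field, field_char_0} fps"
  assumes "c > 0" "e > 0" "fps_nth \<phi> 0 \<noteq> 0"
  shows "\<exists>U a. a \<noteq> 0 \<and> (\<forall>w. w ^ c = 1 \<longrightarrow> fps_nth (U w) 0 = 0 \<and>
    U w ^ c = fps_X ^ (c * e) * (\<phi> oo U w) \<and> fps_nth (U w) e = w * a)"
proof -
  obtain k where k: "c = Suc k" using assms(1) by (cases c) auto
  obtain \<rho> where \<rho>: "\<rho> ^ c = fps_nth \<phi> 0"
    using nth_root_exists[of c "fps_nth \<phi> 0"] assms(1) by auto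
  have \<rho>0: "\<rho> \<noteq> 0" using \<rho> assms by (auto simp: power_0_left)
  define \<psi> where "\<psi> = fps_radical (\<lambda>_ _. \<rho>) c \<phi>"
  have \<psi>: "\<psi> ^ c = \<phi>"
    using power_radical[OF assms(3), of "\<lambda>_ _. \<rho>" k] \<rho> by (simp add: \<psi>_def k)
  then have "fps_nth \<psi> 0 ^ c = fps_nth \<phi> 0" by (metis fps_power_zeroth)
  then have \<psi>0: "fps_nth \<psi> 0 \<noteq> 0" using assms by (auto simp: power_0_left)
  define V where "V = fps_X * inverse \<psi>"
  have V: "fps_nth V 0 = 0" "fps_nth V 1 \<noteq> 0" using \<psi>0 by (simp_all add: V_def)
  define U0 where "U0 = fps_inv V"
  have U00: "fps_nth U0 0 = 0" by (simp add: U0_def fps_inv_def)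
  have "V oo U0 = fps_X" unfolding U0_def using V by (rule fps_inv_right)
  then have "U0 * inverse (\<psi> oo U0) = fps_X"
    using U00 \<psi>0 by (simp add: V_def fps_compose_mult_distrib fps_inverse_compose)
  moreover have nz: "fps_nth (\<psi> oo U0) 0 \<noteq> 0" using \<psi>0 by simp
  ultimately have U0: "U0 = fps_X * (\<psi> oo U0)"
    by (metis inverse_mult_eq_1 mult.assoc mult.right_neutral)
  define a where "a = fps_nth U0 1"
  have "a = fps_nth (fps_X * (\<psi> oo U0)) 1" unfolding a_def by (subst U0) simp
  then have a: "a \<noteq> 0" using nz by simp
  define M where "M w = fps_const w * fps_X ^ e" for w :: 'a
  have M0: "fps_nth (M w) 0 = 0" for w using assms by (simp add: M_def)
  define U where "U w = U0 oo M w" for w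
  have "fps_nth (U w) 0 = 0 \<and> U w ^ c = fps_X ^ (c * e) * (\<phi> oo U w) \<and> fps_nth (U w) e = w * a"
    if w: "w ^ c = 1" for w
  proof (intro conjI)
    show "fps_nth (U w) 0 = 0" by (simp add: U_def U00)
    have "U w = M w * (\<psi> oo U w)"
      unfolding U_def by (subst U0) (simp add: M0 U00 fps_compose_mult_distrib fps_compose_assoc)
    then have "U w ^ c = M w ^ c * (\<psi> oo U w) ^ c" by (metis power_mult_distrib)
    also have "M w ^ c = fps_X ^ (c * e)"
      by (simp add: M_def power_mult_distrib fps_const_power w mult.commute flip: power_mult)
    also have "(\<psi> oo U w) ^ c = \<phi> oo U w"
      by (simp add: fps_compose_power \<psi> \<open>fps_nth (U w) 0 = 0\<close>)
    finally show "U w ^ c = fps_X ^ (c * e) * (\<phi> oo U w)" .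
    have "M w ^ i = fps_const (w ^ i) * fps_X ^ (e * i)" for i
      by (simp add: M_def power_mult_distrib fps_const_power flip: power_mult)
    then have "fps_nth (M w ^ i) e = (if i = 1 then w else 0)" for i
      using assms(2) by (simp add: fps_X_power_nth)
    then have "fps_nth (U w) e = (\<Sum>i=0..e. fps_nth U0 i * (if i = 1 then w else 0))"
      unfolding U_def fps_compose_nth by simp
    also have "\<dots> = (\<Sum>i\<in>{1}. fps_nth U0 i * (if i = 1 then w else 0))"
      by (rule sum.mono_neutral_right) (use assms(2) in auto)
    finally show "fps_nth (U w) e = w * a" by (simp add: a_def)
  qed
  then show ?thesis using a by blast
qed

lemma fps_poly_compose:
  assumes "fps_nth U 0 = (0::'b::idom)"
  shows "fps_of_poly (\<Sum>i\<in>I. Polynomial.monom (q i) i) oo U = (\<Sum>i\<in>I. fps_const (q i) * U ^ i)"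
  using assms by (simp add: fps_of_poly_sum fps_of_poly_monom fps_compose_sum_distrib
      fps_compose_mult_distrib fps_X_power_compose)

text \<open>A small root satisfies \<open>u ^ c = z * \<phi>(u)\<close> with \<open>\<phi>(u) = u ^ c * P(u)\<close> a polynomial whose constant term
  is the weight of the jump \<open>-c\<close>; this is where that weight has to be nonzero.\<close>

lemma small_series_roots:
  fixes p :: "int \<Rightarrow> 'a::{alg_closed_field, field_char_0}"
  assumes "c > 0 \<Longrightarrow> p (- int c) \<noteq> 0" "m > 0" "c > 0 \<Longrightarrow> c dvd m"
  shows "\<exists>R. finite R \<and> card R = c \<and> (\<forall>r\<in>R. r \<noteq> 0 \<and> fps_nth r 0 = 0 \<and>
     poly (kernel_poly (\<lambda>i. fps_const (p i)) c d (fps_X ^ m)) r = 0)"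
proof (cases "c = 0")
  case False
  then obtain e where m: "m = c * e" using assms(3) by (auto elim: dvdE)
  then have "e > 0" using assms(2) by simp
  define \<phi> where "\<phi> = fps_of_poly (\<Sum>i\<le>c+d. Polynomial.monom (p (int i - int c)) i)"
  have "fps_nth \<phi> 0 = p (- int c)"
    by (simp add: \<phi>_def coeff_sum)
  then have "fps_nth \<phi> 0 \<noteq> 0" using assms False by simp
  from series_solutions[OF _ \<open>e > 0\<close> this, of c] False
  obtain U a where a: "a \<noteq> 0" and U: "\<And>w. w ^ c = 1 \<Longrightarrow> fps_nth (U w) 0 = 0"
    "\<And>w. w ^ c = 1 \<Longrightarrow> U w ^ c = fps_X ^ (c * e) * (\<phi> oo U w)"
    "\<And>w. w ^ c = 1 \<Longrightarrow> fps_nth (U w) e = w * a" by blast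
  define R where "R = U ` {w. w ^ c = 1}"
  have c: "card {w::'a. w ^ c = 1} = c" using card_roots_of_unity False by auto
  have "inj_on U {w. w ^ c = 1}"
  proof (rule inj_onI, clarsimp)
    fix w v assume "w ^ c = 1" "v ^ c = 1" "U w = U v"
    then have "w * a = v * a" using U(3) by metis
    then show "w = v" using a by simp
  qed
  then have "card R = c" by (simp add: R_def card_image c)
  moreover have "finite R" using \<open>card R = c\<close> False by (metis card.infinite)
  moreover have "r \<noteq> 0 \<and> fps_nth r 0 = 0 \<and>
     poly (kernel_poly (\<lambda>i. fps_const (p i)) c d (fps_X ^ m)) r = 0" if "r \<in> R" for r
  proof -
    obtain w where w: "w ^ c = 1" "r = U w" using \<open>r \<in> R\<close> by (auto simp: R_def)
    have "fps_nth r e \<noteq> 0" using U(3)[OF w(1)] w a False by (auto simp: power_0_left)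
    moreover have "\<phi> oo U w = (\<Sum>i\<le>c+d. fps_const (p (int i - int c)) * U w ^ i)"
      unfolding \<phi>_def by (rule fps_poly_compose[OF U(1)[OF w(1)]])
    ultimately show ?thesis using U(1,2)[OF w(1)] w(2) by (auto simp: poly_kernel_poly m)
  qed
  ultimately show ?thesis by blast
qed (auto intro: exI[of _ "{}"])

lemma poly_kernel_poly_hom:
  fixes h :: "'b::comm_ring_1 \<Rightarrow> 'c::comm_ring_1"
  assumes h: "h 1 = 1" "\<And>x y. h (x - y) = h x - h y" "\<And>x y. h (x * y) = h x * h y"
  shows "poly (kernel_poly (\<lambda>i. h (p i)) c d (h z)) (h r) = h (poly (kernel_poly p c d z) r)"
proof -
  have 0: "h 0 = 0" using h(2)[of 1 1] by simp
  have add: "h (x + y) = h x + h y" for x y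
    using h(2)[of x "0 - y"] h(2)[of 0 y] 0 by simp
  have sum: "h (sum f I) = (\<Sum>i\<in>I. h (f i))" for f and I :: "nat set"
    by (induction I rule: infinite_finite_induct) (simp_all add: 0 add)
  have power: "h (x ^ n) = h x ^ n" for x n
    by (induction n) (simp_all add: h)
  show ?thesis by (simp add: poly_kernel_poly h(2,3) sum power)
qed

lemma poly_kernel_poly_fps_to_fls:
  fixes p :: "int \<Rightarrow> 'b::field"
  shows "poly (kernel_poly (\<lambda>i. fls_const (p i)) c d (fls_X ^ m)) (fps_to_fls r) =
    fps_to_fls (poly (kernel_poly (\<lambda>i. fps_const (p i)) c d (fps_X ^ m)) r)"
  using poly_kernel_poly_hom[of fps_to_fls "\<lambda>i. fps_const (p i)" c d "fps_X ^ m" r]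
  by (simp add: fls_times_fps_to_fls fps_to_fls_power)

lemma kernel_roots_eq:
  "kernel_roots p c d m =
    {r. r \<noteq> 0 \<and> poly (kernel_poly (\<lambda>i. fls_const (p i)) c d (fls_X ^ m)) r = 0}"
  unfolding kernel_roots_def by (auto simp: poly_kernel_poly_field)

lemma kernel_poly_nonzero:
  assumes "m > 0"
  shows "kernel_poly (\<lambda>i. fls_const (p i)) c d (fls_X ^ m :: 'b::field fls) \<noteq> 0"
proof
  assume "kernel_poly (\<lambda>i. fls_const (p i)) c d (fls_X ^ m :: 'b fls) = 0"
  then have "Polynomial.coeff (kernel_poly (\<lambda>i. fls_const (p i)) c d (fls_X ^ m :: 'b fls)) c = 0"
    by simp
  then have "(1 :: 'b fls) = fls_const (p 0) * fls_X ^ m" by (simp add: coeff_kernel_poly mult.commute)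
  then have "fls_nth (1 :: 'b fls) 0 = fls_nth (fls_const (p 0) * fls_X ^ m) 0" by (rule arg_cong)
  then show False using assms by simp
qed

text \<open>There are \<open>c\<close> small and \<open>d\<close> large explicit roots. They are distinct, and a polynomial of degree at
  most \<open>c + d\<close> has no room for others.\<close>

lemma kernel_roots_structure:
  fixes p :: "int \<Rightarrow> 'a::{alg_closed_field, field_char_0}"
  assumes "c > 0 \<Longrightarrow> p (- int c) \<noteq> 0" "d > 0 \<Longrightarrow> p (int d) \<noteq> 0"
    and m: "m > 0" "c > 0 \<Longrightarrow> c dvd m" "d > 0 \<Longrightarrow> d dvd m"
  shows "\<exists>R R'. finite R \<and> card R = c \<and> (\<forall>r\<in>R. fps_nth r 0 = 0 \<and>
        poly (kernel_poly (\<lambda>i. fps_const (p i)) c d (fps_X ^ m)) r = 0) \<and>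
      finite R' \<and> card R' = d \<and> (\<forall>r\<in>R'. fps_nth r 0 = 0 \<and>
        poly (kernel_poly (\<lambda>i. fps_const (p (- i))) d c (fps_X ^ m)) r = 0) \<and>
      small_roots p c d m = fps_to_fls ` R \<and>
      large_roots p c d m = (\<lambda>r. inverse (fps_to_fls r)) ` R' \<and>
      kernel_roots p c d m = fps_to_fls ` R \<union> (\<lambda>r. inverse (fps_to_fls r)) ` R'"
proof -
  obtain R where R: "finite R" "card R = c" "\<And>r. r \<in> R \<Longrightarrow> r \<noteq> 0" "\<And>r. r \<in> R \<Longrightarrow> fps_nth r 0 = 0"
    "\<And>r. r \<in> R \<Longrightarrow> poly (kernel_poly (\<lambda>i. fps_const (p i)) c d (fps_X ^ m)) r = 0"
    using small_series_roots[of c p m d] assms by blast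
  obtain R' where R': "finite R'" "card R' = d" "\<And>r. r \<in> R' \<Longrightarrow> r \<noteq> 0" "\<And>r. r \<in> R' \<Longrightarrow> fps_nth r 0 = 0"
    "\<And>r. r \<in> R' \<Longrightarrow> poly (kernel_poly (\<lambda>i. fps_const (p (- i))) d c (fps_X ^ m)) r = 0"
    using small_series_roots[of d "\<lambda>i. p (- i)" m c] assms by auto
  define S where "S = fps_to_fls ` R"
  define L where "L = (\<lambda>r. inverse (fps_to_fls r)) ` R'"
  define K where "K = kernel_poly (\<lambda>i. fls_const (p i)) c d (fls_X ^ m)"
  have sub: "fls_subdegree (fps_to_fls r) > 0" if "r \<noteq> 0" "fps_nth r 0 = 0" for r :: "'a fps"
    using that by (simp add: fls_subdegree_fls_to_fps subdegree_eq_0_iff zero_less_iff_neq_zero)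
  have subS: "fls_subdegree r > 0" if "r \<in> S" for r
    using that sub R by (auto simp: S_def)
  have subL: "fls_subdegree r < 0" if "r \<in> L" for r
    using that sub R' by (auto simp: L_def)
  have "card S = c" unfolding S_def by (subst card_image) (auto simp: inj_on_def R)
  moreover have "card L = d" unfolding L_def by (subst card_image) (auto simp: inj_on_def R')
  moreover have "S \<inter> L = {}" using subS subL by fastforce
  moreover have fin: "finite S" "finite L" by (simp_all add: S_def L_def R R')
  ultimately have card: "card (S \<union> L) = c + d" by (simp add: card_Un_disjoint)
  have K0: "K \<noteq> 0" unfolding K_def by (rule kernel_poly_nonzero[OF m(1)])
  have roots: "kernel_roots p c d m = {r. r \<noteq> 0 \<and> poly K r = 0}"
    by (simp add: kernel_roots_eq K_def)
  have "S \<union> L \<subseteq> kernel_roots p c d m"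
  proof
    fix r assume "r \<in> S \<union> L"
    then consider s where "s \<in> R" "r = fps_to_fls s" | s where "s \<in> R'" "r = inverse (fps_to_fls s)"
      by (auto simp: S_def L_def)
    then show "r \<in> kernel_roots p c d m"
    proof cases
      case 1
      then show ?thesis using R by (simp add: roots K_def poly_kernel_poly_fps_to_fls)
    next
      case 2
      then show ?thesis using R' by (simp add: roots K_def poly_kernel_poly_inverse poly_kernel_poly_fps_to_fls)
    qed
  qed
  \<comment> \<open>The kernel has degree at most \<open>c + d\<close>, so the roots found so far are all of them.\<close>
  moreover have "card (kernel_roots p c d m) \<le> card (S \<union> L)"
  proof -
    have "card (kernel_roots p c d m) \<le> card {r. poly K r = 0}"
      by (rule card_mono[OF poly_roots_finite[OF K0]]) (auto simp: roots)
    also have "\<dots> \<le> Polynomial.degree K" by (rule card_poly_roots_bound[OF K0])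
    also have "\<dots> \<le> c + d" by (rule degree_le) (simp add: K_def coeff_kernel_poly)
    finally show ?thesis by (simp add: card)
  qed
  moreover have "finite (kernel_roots p c d m)"
    by (rule finite_subset[OF _ poly_roots_finite[OF K0]]) (auto simp: roots)
  ultimately have eq: "kernel_roots p c d m = S \<union> L" by (metis card_seteq)
  have "small_roots p c d m = S" using subS subL by (fastforce simp: small_roots_def eq)
  moreover have "large_roots p c d m = L" using subS subL by (fastforce simp: large_roots_def eq)
  ultimately show ?thesis
    by (intro exI[of _ R] exI[of _ R']) (simp add: R R' eq flip: S_def L_def)
qed

section \<open>The kernel method over rings of power series\<close>

text \<open>The coefficients of all linear relations below are power series that belong to the field generated
  by the roots. These series form a ring in which a series with nonzero constant term is invertible,
  and the locale captures just that. A series with constant term 0 counts as small.\<close>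

locale series_subring =
  fixes A :: "'b::field fps set"
  assumes one: "1 \<in> A"
    and diff: "x \<in> A \<Longrightarrow> y \<in> A \<Longrightarrow> x - y \<in> A"
    and mult: "x \<in> A \<Longrightarrow> y \<in> A \<Longrightarrow> x * y \<in> A"
    and inverse: "x \<in> A \<Longrightarrow> fps_nth x 0 \<noteq> 0 \<Longrightarrow> inverse x \<in> A"
begin

definition submodule :: "'b fps set \<Rightarrow> bool" where
  "submodule N \<longleftrightarrow> 0 \<in> N \<and> (\<forall>x\<in>N. \<forall>y\<in>N. x - y \<in> N) \<and> (\<forall>a\<in>A. \<forall>x\<in>N. a * x \<in> N)"

lemma submoduleD:
  assumes "submodule N"
  shows "0 \<in> N" "x \<in> N \<Longrightarrow> y \<in> N \<Longrightarrow> x - y \<in> N" "a \<in> A \<Longrightarrow> x \<in> N \<Longrightarrow> a * x \<in> N"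
    "x \<in> N \<Longrightarrow> y \<in> N \<Longrightarrow> x + y \<in> N"
proof -
  show *: "0 \<in> N" "x \<in> N \<Longrightarrow> y \<in> N \<Longrightarrow> x - y \<in> N" "a \<in> A \<Longrightarrow> x \<in> N \<Longrightarrow> a * x \<in> N" for x y a
    using assms by (auto simp: submodule_def)
  show "x + y \<in> N" if "x \<in> N" "y \<in> N"
    using *(2)[OF that(1) *(2)[OF *(1) that(2)]] by simp
qed

lemma submodule_sum:
  assumes "submodule N" "\<And>i. i \<in> I \<Longrightarrow> f i \<in> N"
  shows "sum f I \<in> N"
  using assms(2) by (induction I rule: infinite_finite_induct) (auto intro: submoduleD[OF assms(1)])

lemma zero: "0 \<in> A" using diff[OF one one] by simp

lemma submodule_self: "submodule A"
  by (auto simp: submodule_def zero diff mult)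

lemma add: "x \<in> A \<Longrightarrow> y \<in> A \<Longrightarrow> x + y \<in> A"
  by (rule submoduleD(4)[OF submodule_self])

lemma uminus: "x \<in> A \<Longrightarrow> - x \<in> A"
  using diff[OF zero] by simp

text \<open>The convolution of \<open>S\<close> with a monic polynomial of degree \<open>c\<close>, whose lower coefficients are given by
  \<open>T\<close>, expresses \<open>S k\<close> in terms of later values of \<open>S\<close>. Once \<open>S\<close> is known to end, this determines it
  by downward recursion.\<close>

lemma back_substitution:
  fixes S T :: "nat \<Rightarrow> 'b fps"
  assumes N: "submodule N" and T: "\<And>i. i < c \<Longrightarrow> T i \<in> A"
    and S: "\<And>k. k > d \<Longrightarrow> S k = 0"
    and B: "\<And>k. k \<ge> l \<Longrightarrow> S k + (\<Sum>i<c. T i * S (k + c - i)) \<in> N"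
    and "k \<ge> l"
  shows "S k \<in> N"
  using \<open>k \<ge> l\<close>
proof (induction "d - k" arbitrary: k rule: less_induct)
  case less
  show ?case
  proof (cases "k > d")
    case True
    then show ?thesis using S submoduleD(1)[OF N] by simp
  next
    case False
    have "T i * S (k + c - i) \<in> N" if "i < c" for i
    proof (cases "k + c - i > d")
      case True
      then show ?thesis using S submoduleD(1)[OF N] by simp
    next
      case *: False
      have "S (k + c - i) \<in> N" by (rule less.hyps) (use False * that less.prems in auto)
      then show ?thesis using submoduleD(3)[OF N] T that by blast
    qed
    then have "(\<Sum>i<c. T i * S (k + c - i)) \<in> N" by (intro submodule_sum[OF N]) auto
    from submoduleD(2)[OF N B[OF less.prems] this] show ?thesis by simp
  qed
qed

text \<open>If the lower coefficients of the monic polynomial are small, the homogeneous equation at \<open>k\<close>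
  expresses the coefficient of order \<open>n\<close> of \<open>S k\<close> by coefficients of lower order of later values, so
  that \<open>S\<close> vanishes wherever the equation holds from then on. This replaces the substitution of the small roots for
  \<open>u\<close> in the kernel method, and it involves no infinite sums in \<open>u\<close>.\<close>

lemma contraction_eq_0:
  fixes S T :: "nat \<Rightarrow> 'b fps"
  assumes T: "\<And>i. i < c \<Longrightarrow> fps_nth (T i) 0 = 0"
    and B: "\<And>k. k > d \<Longrightarrow> S k + (\<Sum>i<c. T i * S (k + c - i)) = 0"
    and "k > d"
  shows "S k = 0"
proof -
  have "fps_nth (S k) n = 0" if "k > d" for n k
    using that
  proof (induction n arbitrary: k rule: less_induct)
    case (less n)
    have "fps_nth (T i * S (k + c - i)) n = 0" if "i < c" for i
    proof -
      have "fps_nth (T i) j * fps_nth (S (k + c - i)) (n - j) = 0" if "j \<le> n" for j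
        using T[OF \<open>i < c\<close>] less.IH[of "n - j" "k + c - i"] \<open>i < c\<close> that less.prems
        by (cases "j = 0") auto
      then show ?thesis unfolding fps_mult_nth by (intro sum.neutral) auto
    qed
    moreover have "fps_nth (S k + (\<Sum>i<c. T i * S (k + c - i))) n = 0"
      using B[OF less.prems] by simp
    ultimately show ?case by (simp add: fps_sum_nth)
  qed
  then show ?thesis using \<open>k > d\<close> by (intro fps_ext) simp
qed

lemma prod_linear_factors_coeffs:
  assumes "finite R" "R \<subseteq> A" "\<And>r. r \<in> R \<Longrightarrow> fps_nth r 0 = 0"
  defines "T \<equiv> (\<Prod>r\<in>R. [:- r, 1:])"
  shows "\<And>i. Polynomial.coeff T i \<in> A" "Polynomial.coeff T (card R) = 1"
    "\<And>i. i < card R \<Longrightarrow> fps_nth (Polynomial.coeff T i) 0 = 0"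
    "\<And>i. i > card R \<Longrightarrow> Polynomial.coeff T i = 0"
proof -
  have "(\<forall>i. Polynomial.coeff T i \<in> A) \<and> Polynomial.coeff T (card R) = 1 \<and>
    (\<forall>i < card R. fps_nth (Polynomial.coeff T i) 0 = 0) \<and> (\<forall>i > card R. Polynomial.coeff T i = 0)"
    unfolding T_def using assms(1-3)
  proof (induction R rule: finite_induct)
    case empty
    then show ?case by (simp add: one zero)
  next
    case (insert r R)
    let ?D = "\<Prod>r\<in>R. [:- r, 1:]"
    have eq: "Polynomial.coeff (\<Prod>r\<in>insert r R. [:- r, 1:]) i =
        (case i of 0 \<Rightarrow> 0 | Suc j \<Rightarrow> Polynomial.coeff ?D j) - r * Polynomial.coeff ?D i" for i
      unfolding prod.insert[OF insert.hyps] by (simp add: coeff_pCons)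
    have R: "R \<subseteq> A" "\<And>s. s \<in> R \<Longrightarrow> fps_nth s 0 = 0" and r: "r \<in> A" "fps_nth r 0 = 0"
      using insert.prems by auto
    from insert.IH[OF R]
    have D: "\<And>i. Polynomial.coeff ?D i \<in> A" "Polynomial.coeff ?D (card R) = 1"
      "\<And>i. i < card R \<Longrightarrow> fps_nth (Polynomial.coeff ?D i) 0 = 0"
      "\<And>i. i > card R \<Longrightarrow> Polynomial.coeff ?D i = 0" by blast+
    show ?case unfolding eq card_insert_disjoint[OF insert.hyps]
    proof (intro conjI allI impI)
      show "(case i of 0 \<Rightarrow> 0 | Suc j \<Rightarrow> Polynomial.coeff ?D j) - r * Polynomial.coeff ?D i \<in> A" for i
        using D(1) r(1) by (cases i) (auto intro!: diff uminus mult zero)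
      show "fps_nth ((case i of 0 \<Rightarrow> 0 | Suc j \<Rightarrow> Polynomial.coeff ?D j) - r * Polynomial.coeff ?D i) 0 = 0"
        if "i < Suc (card R)" for i
        using D(3) r(2) that by (cases i) auto
      show "(case i of 0 \<Rightarrow> 0 | Suc j \<Rightarrow> Polynomial.coeff ?D j) - r * Polynomial.coeff ?D i = 0"
        if "i > Suc (card R)" for i
        using D(4) that by (cases i) auto
    qed (use D(2,4) in simp)
  qed
  then show "\<And>i. Polynomial.coeff T i \<in> A" "Polynomial.coeff T (card R) = 1"
    "\<And>i. i < card R \<Longrightarrow> fps_nth (Polynomial.coeff T i) 0 = 0"
    "\<And>i. i > card R \<Longrightarrow> Polynomial.coeff T i = 0" by blast+
qed

end

lemma monic_poly_mult_nth:
  fixes T :: "'c::comm_ring_1 poly"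
  assumes "Polynomial.coeff T c = 1" "\<And>i. i > c \<Longrightarrow> Polynomial.coeff T i = 0"
  shows "fps_nth (fps_of_poly T * S) (k + c) =
    fps_nth S k + (\<Sum>i<c. Polynomial.coeff T i * fps_nth S (k + c - i))"
proof -
  have "fps_nth (fps_of_poly T * S) (k + c) =
      (\<Sum>i=0..k+c. Polynomial.coeff T i * fps_nth S (k + c - i))"
    by (simp add: fps_mult_nth)
  also have "\<dots> = (\<Sum>i\<le>c. Polynomial.coeff T i * fps_nth S (k + c - i))"
    by (rule sum.mono_neutral_right) (use assms(2) in auto)
  also have "{..c} = insert c {..<c}" by auto
  finally show ?thesis using assms(1) by simp
qed

text \<open>In this lemma and in \<open>half_line\<close> the outer power series have the altitude as their exponent.
  The value 0 at \<open>k = 0\<close> cuts off the part of \<open>w\<close> that does not lie on the positive half-line.\<close>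

lemma kernel_poly_mult_nth:
  fixes p :: "int \<Rightarrow> 'c::comm_ring_1" and w :: "int \<Rightarrow> 'c"
  shows "fps_nth (fps_of_poly (kernel_poly p c d z) *
      Abs_fps (\<lambda>k. if k = 0 then 0 else w (int k))) (k + c) =
    (if k = 0 then 0 else w (int k)) -
      z * (\<Sum>i=-int c..int d. p i * (if int k - i > 0 then w (int k - i) else 0))"
proof -
  let ?w = "\<lambda>k. if k = 0 then 0 else w (int k)"
  let ?h = "\<lambda>j. p (int j - int c) * (if int k - (int j - int c) > 0 then w (int k - (int j - int c)) else 0)"
  have "fps_nth (fps_of_poly (kernel_poly p c d z) * Abs_fps ?w) (k + c) =
     (\<Sum>j=0..k+c. ((if j = c then 1 else 0) - (if j \<le> c + d then z * p (int j - int c) else 0)) * ?w (k + c - j))"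
    by (simp add: fps_mult_nth coeff_kernel_poly)
  also have "\<dots> = (\<Sum>j=0..k+c. (if j = c then ?w k else 0) - (if j \<le> c + d then z * ?h j else 0))"
  proof (rule sum.cong[OF refl])
    fix j assume "j \<in> {0..k+c}"
    then have "?w (k + c - j) = (if int k - (int j - int c) > 0 then w (int k - (int j - int c)) else 0)"
      by (auto simp: of_nat_diff algebra_simps)
    moreover have "?w (k + c - j) = ?w k" if "j = c" using that by simp
    ultimately show "((if j = c then 1 else 0) - (if j \<le> c + d then z * p (int j - int c) else 0)) * ?w (k + c - j) =
      (if j = c then ?w k else 0) - (if j \<le> c + d then z * ?h j else 0)"
      by (simp only: left_diff_distrib mult.assoc) (auto simp: mult.assoc)
  qed
  also have "\<dots> = ?w k - (\<Sum>j=0..k+c. if j \<le> c + d then z * ?h j else 0)"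
    by (subst sum_subtractf) simp
  also have "(\<Sum>j=0..k+c. if j \<le> c + d then z * ?h j else 0) = (\<Sum>j\<le>c+d. z * ?h j)"
    by (rule sum.mono_neutral_cong) auto
  also have "\<dots> = z * (\<Sum>j\<le>c+d. ?h j)"
    by (simp only: sum_distrib_left)
  also have "(\<Sum>j\<le>c+d. ?h j) = (\<Sum>i=-int c..int d. p i * (if int k - i > 0 then w (int k - i) else 0))"
    by (rule sum_jumps_reindex)
  finally show ?thesis .
qed

context series_subring
begin

text \<open>On the positive half-line \<open>w\<close> satisfies the recurrence with symbol \<open>1 - z * P(u)\<close>, up to source
  terms. The kernel polynomial factors as \<open>T * \<kappa>\<close>, where \<open>T\<close> has the small roots as its roots. For the
  series \<open>W\<close> with coefficients \<open>w k\<close>, the product \<open>S = \<kappa> * W\<close> satisfies an equation with symbol \<open>T\<close> whose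
  right-hand side is the source. Beyond degree \<open>d\<close> there is no source and \<open>S\<close> vanishes by contraction;
  the other coefficients follow by back substitution, and dividing by \<open>\<kappa>\<close> gives \<open>w\<close>. Each operation
  preserves membership in a submodule containing the source.\<close>

lemma half_line:
  assumes p: "\<And>i. i \<in> {-int c..int d} \<Longrightarrow> p i \<in> A" and z: "z \<in> A" "fps_nth z 0 = 0"
    and R: "finite R" "card R = c" "R \<subseteq> A" "\<And>r. r \<in> R \<Longrightarrow> fps_nth r 0 = 0"
      "\<And>r. r \<in> R \<Longrightarrow> poly (kernel_poly p c d z) r = 0"
    and N: "submodule N"
    and source: "\<And>k. k > 0 \<Longrightarrow>
      w k - z * (\<Sum>i=-int c..int d. p i * (if k - i > 0 then w (k - i) else 0)) \<in> N"
    and source_eq_0: "\<And>k. k > int d \<Longrightarrow>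
      w k - z * (\<Sum>i=-int c..int d. p i * (if k - i > 0 then w (k - i) else 0)) = 0"
    and "k > 0"
  shows "w k \<in> N"
proof -
  define K where "K = kernel_poly p c d z"
  define T where "T = (\<Prod>r\<in>R. [:- r, 1:])"
  note T = prod_linear_factors_coeffs[OF R(1,3,4), folded T_def, unfolded R(2)]
  have "T dvd K" unfolding T_def K_def by (rule prod_linear_factors_dvd) (use R in auto)
  then obtain \<kappa> where \<kappa>: "K = T * \<kappa>" by (auto elim: dvdE)
  have K_coeff: "Polynomial.coeff K n \<in> A" for n
    using p z(1) by (auto simp: K_def coeff_kernel_poly intro!: diff uminus mult one zero)
  have K_nth: "Polynomial.coeff K (k + c) = Polynomial.coeff \<kappa> k +
      (\<Sum>i<c. Polynomial.coeff T i * Polynomial.coeff \<kappa> (k + c - i))" for k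
    using monic_poly_mult_nth[OF T(2,4), of "fps_of_poly \<kappa>" k]
    by (simp add: \<kappa> flip: fps_of_poly_mult)
  have \<kappa>_A: "Polynomial.coeff \<kappa> k \<in> A" for k
  proof (rule back_substitution[where N = A and S = "Polynomial.coeff \<kappa>"
        and T = "Polynomial.coeff T" and c = c and d = "Polynomial.degree \<kappa>" and l = 0])
    show "Polynomial.coeff \<kappa> k + (\<Sum>i<c. Polynomial.coeff T i * Polynomial.coeff \<kappa> (k + c - i)) \<in> A" for k
      using K_coeff[of "k + c"] by (simp only: K_nth)
  qed (use T(1) submodule_self in \<open>auto simp: coeff_eq_0\<close>)
  \<comment> \<open>Modulo small series both the kernel polynomial and \<open>T\<close> are \<open>u ^ c\<close>, hence \<open>\<kappa>\<close> is 1.\<close>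
  have "fps_nth (Polynomial.coeff K (0 + c)) 0 = 1"
    using z(2) by (simp add: K_def coeff_kernel_poly)
  then have \<kappa>0: "fps_nth (Polynomial.coeff \<kappa> 0) 0 = 1"
    unfolding K_nth using T(3) by (simp add: fps_sum_nth)
  define W where "W = Abs_fps (\<lambda>k. if k = 0 then 0 else w (int k))"
  define S where "S = fps_of_poly \<kappa> * W"
  have S: "fps_nth S k + (\<Sum>i<c. Polynomial.coeff T i * fps_nth S (k + c - i)) =
      w (int k) - z * (\<Sum>i=-int c..int d. p i * (if int k - i > 0 then w (int k - i) else 0))"
    if "k > 0" for k
    using monic_poly_mult_nth[OF T(2,4), of S k] kernel_poly_mult_nth[of p c d z w k] that
    by (simp add: S_def W_def \<kappa> fps_of_poly_mult mult.assoc flip: K_def)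
  have S_0: "fps_nth S k = 0" if "k > d" for k
    by (rule contraction_eq_0[where S = "fps_nth S" and T = "Polynomial.coeff T" and c = c, OF T(3) _ that])
      (use S source_eq_0 in auto)
  have S_N: "fps_nth S k \<in> N" if "k > 0" for k
    by (rule back_substitution[where S = "fps_nth S" and T = "Polynomial.coeff T" and c = c and d = d and l = 1,
          OF N T(1) S_0])
      (use S source that in auto)
  have "fps_nth W k \<in> N" for k
  proof (induction k rule: less_induct)
    case (less k)
    show ?case
    proof (cases "k = 0")
      case True
      then show ?thesis using submoduleD(1)[OF N] by (simp add: W_def)
    next
      case False
      have "fps_nth S k = (\<Sum>i=0..k. Polynomial.coeff \<kappa> i * fps_nth W (k - i))"
        by (simp add: S_def fps_mult_nth)
      also have "\<dots> = Polynomial.coeff \<kappa> 0 * fps_nth W k +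
          (\<Sum>i=1..k. Polynomial.coeff \<kappa> i * fps_nth W (k - i))"
        by (simp add: sum.atLeast_Suc_atMost)
      finally have "Polynomial.coeff \<kappa> 0 * fps_nth W k =
          fps_nth S k - (\<Sum>i=1..k. Polynomial.coeff \<kappa> i * fps_nth W (k - i))" by simp
      also have "\<dots> \<in> N"
        using S_N False less.IH \<kappa>_A by (intro submoduleD(2)[OF N] submodule_sum[OF N] submoduleD(3)[OF N]) auto
      finally have "inverse (Polynomial.coeff \<kappa> 0) * (Polynomial.coeff \<kappa> 0 * fps_nth W k) \<in> N"
        by (rule submoduleD(3)[OF N inverse[OF \<kappa>_A], rotated]) (simp add: \<kappa>0)
      moreover have "inverse (Polynomial.coeff \<kappa> 0) * Polynomial.coeff \<kappa> 0 = 1"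
        by (rule inverse_mult_eq_1) (simp add: \<kappa>0)
      ultimately show ?thesis by (simp only: mult.assoc[symmetric] mult_1_left)
    qed
  qed
  from this[of "nat k"] show ?thesis using \<open>k > 0\<close> by (simp add: W_def)
qed

definition small_combinations :: "('i \<Rightarrow> 'b fps) \<Rightarrow> 'i set \<Rightarrow> 'b fps set" where
  "small_combinations x I = {\<Sum>j\<in>I. m j * x j |m. \<forall>j\<in>I. m j \<in> A \<and> fps_nth (m j) 0 = 0}"

lemma submodule_small_combinations: "submodule (small_combinations x I)"
  unfolding submodule_def
proof (intro conjI ballI)
  show "0 \<in> small_combinations x I"
    unfolding small_combinations_def by (rule CollectI, rule exI[of _ "\<lambda>_. 0"]) (simp add: zero)
next
  fix a b assume "a \<in> small_combinations x I" "b \<in> small_combinations x I"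
  then obtain m n where "a = (\<Sum>j\<in>I. m j * x j)" "\<forall>j\<in>I. m j \<in> A \<and> fps_nth (m j) 0 = 0"
    "b = (\<Sum>j\<in>I. n j * x j)" "\<forall>j\<in>I. n j \<in> A \<and> fps_nth (n j) 0 = 0"
    by (auto simp: small_combinations_def)
  then show "a - b \<in> small_combinations x I"
    unfolding small_combinations_def
    by (intro CollectI exI[of _ "\<lambda>j. m j - n j"]) (simp add: left_diff_distrib sum_subtractf diff)
next
  fix a b assume "a \<in> A" "b \<in> small_combinations x I"
  then obtain m where "b = (\<Sum>j\<in>I. m j * x j)" "\<forall>j\<in>I. m j \<in> A \<and> fps_nth (m j) 0 = 0"
    by (auto simp: small_combinations_def)
  then show "a * b \<in> small_combinations x I"
    using \<open>a \<in> A\<close> unfolding small_combinations_def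
    by (intro CollectI exI[of _ "\<lambda>j. a * m j"]) (simp add: sum_distrib_left mult.assoc mult)
qed

lemma small_combinations_single:
  assumes "finite I" "i \<in> I" "a \<in> A" "fps_nth a 0 = 0"
  shows "a * x i \<in> small_combinations x I"
  unfolding small_combinations_def
  by (intro CollectI exI[of _ "\<lambda>j. if j = i then a else 0"])
    (use assms in \<open>simp add: zero if_distrib[of "\<lambda>a. a * _"] cong: if_cong\<close>)

text \<open>A linear system \<open>x = e + M x\<close> over the subring with small entries in \<open>M\<close> is solved by Gaussian
  elimination: the pivots \<open>1 - M i i\<close> are invertible, and eliminating a variable keeps all entries
  small.\<close>

lemma contracting_system_solution:
  assumes "finite I" "\<And>i. i \<in> I \<Longrightarrow> \<exists>e\<in>A. x i - e \<in> small_combinations x I" "i \<in> I"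
  shows "x i \<in> A"
  using assms
proof (induction I arbitrary: i rule: finite_induct)
  case (insert a I)
  have ex: "\<exists>e m l. e \<in> A \<and> (\<forall>j\<in>I. m j \<in> A \<and> fps_nth (m j) 0 = 0) \<and> l \<in> A \<and> fps_nth l 0 = 0 \<and>
      x i = e + l * x a + (\<Sum>j\<in>I. m j * x j)" if i: "i \<in> insert a I" for i
  proof -
    obtain e m where "e \<in> A" "\<forall>j\<in>insert a I. m j \<in> A \<and> fps_nth (m j) 0 = 0"
      "x i - e = (\<Sum>j\<in>insert a I. m j * x j)"
      using insert.prems(1)[OF i] by (auto simp: small_combinations_def)
    then show ?thesis using insert.hyps
      by (intro exI[of _ e] exI[of _ m] exI[of _ "m a"]) (auto simp: algebra_simps)
  qed
  obtain e m l where a: "e \<in> A" "\<And>j. j \<in> I \<Longrightarrow> m j \<in> A \<and> fps_nth (m j) 0 = 0" "l \<in> A" "fps_nth l 0 = 0"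
    "x a = e + l * x a + (\<Sum>j\<in>I. m j * x j)" using ex[of a] by blast
  define v where "v = inverse (1 - l)"
  have v: "v \<in> A" unfolding v_def using a by (intro inverse diff one) auto
  have "v * (1 - l) = 1" unfolding v_def by (rule inverse_mult_eq_1) (use a in simp)
  moreover have "(1 - l) * x a = e + (\<Sum>j\<in>I. m j * x j)" using a(5) by (simp add: algebra_simps)
  ultimately have xa: "x a = v * (e + (\<Sum>j\<in>I. m j * x j))"
    by (metis mult.assoc mult.left_neutral)
  have I: "x i \<in> A" if "i \<in> I" for i
  proof (rule insert.IH[OF _ that])
    fix i assume "i \<in> I"
    then obtain e' m' l' where i: "e' \<in> A" "\<And>j. j \<in> I \<Longrightarrow> m' j \<in> A \<and> fps_nth (m' j) 0 = 0"
      "l' \<in> A" "fps_nth l' 0 = 0" "x i = e' + l' * x a + (\<Sum>j\<in>I. m' j * x j)"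
      using ex[of i] by blast
    have "x i - (e' + l' * v * e) = (\<Sum>j\<in>I. (m' j + l' * v * m j) * x j)"
      by (subst i(5), subst xa) (simp add: algebra_simps sum.distrib sum_distrib_left)
    moreover have "e' + l' * v * e \<in> A" using i a v by (intro add mult)
    ultimately show "\<exists>e\<in>A. x i - e \<in> small_combinations x I"
      unfolding small_combinations_def using i a v
      by (intro bexI[of _ "e' + l' * v * e"] CollectI exI[of _ "\<lambda>j. m' j + l' * v * m j"])
        (auto intro!: add mult)
  qed
  have "x a \<in> A" unfolding xa
    using a v I by (intro mult add submodule_sum[OF submodule_self]) auto
  then show ?case using I insert.prems(2) by auto
qed simp

text \<open>By \<open>half_line\<close> and its mirror image every \<open>w k\<close> with \<open>k \<noteq> 0\<close> is a small combination of the \<open>w l\<close> with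
  \<open>-d \<le> l \<le> c\<close>, since the source on either side of the axis is \<open>z\<close> times a combination of such \<open>w l\<close>. So is
  \<open>w 0 - 1\<close>, directly by the recurrence. Restricted to \<open>-d \<le> k \<le> c\<close> this is a contracting system.\<close>

lemma boundary_series_in_subring:
  fixes w :: "int \<Rightarrow> 'b fps" and p :: "int \<Rightarrow> 'b fps"
  assumes p: "\<And>i. p i \<in> A" and z: "z \<in> A" "fps_nth z 0 = 0" and q: "q \<in> A"
    and R: "finite R" "card R = c" "R \<subseteq> A" "\<And>r. r \<in> R \<Longrightarrow> fps_nth r 0 = 0"
      "\<And>r. r \<in> R \<Longrightarrow> poly (kernel_poly p c d z) r = 0"
    and R': "finite R'" "card R' = d" "R' \<subseteq> A" "\<And>r. r \<in> R' \<Longrightarrow> fps_nth r 0 = 0"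
      "\<And>r. r \<in> R' \<Longrightarrow> poly (kernel_poly (\<lambda>i. p (- i)) d c z) r = 0"
    and w: "\<And>k. w k = (if k = 0 then 1 else 0) + z *
      (\<Sum>i=-int c..int d. p i * (if (k - i) * k < 0 then q else 1) * w (k - i))"
    and k: "k \<in> {-int d..int c}"
  shows "w k \<in> A"
proof (rule contracting_system_solution[OF _ _ k])
  define N where "N = small_combinations w {-int d..int c}"
  have N: "submodule N" unfolding N_def by (rule submodule_small_combinations)
  have z_w: "z * w k \<in> N" if "k \<in> {-int d..int c}" for k
    unfolding N_def by (rule small_combinations_single) (use that z in auto)
  have p_q: "p i * (if b then q else 1) \<in> A" for i b
    using p q by (auto intro: mult)
  have step_N: "(if b then 0 else p i * (if b' then q else 1) * (z * w l)) \<in> N"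
    if "\<not> b \<Longrightarrow> l \<in> {-int d..int c}" for b b' i l
    using that submoduleD(1)[OF N] submoduleD(3)[OF N p_q z_w] by (cases b) simp_all
  have source: "w k - z * (\<Sum>i=-int c..int d. p i * (if k - i > 0 then w (k - i) else 0)) =
      (\<Sum>i=-int c..int d. if k - i > 0 then 0 else p i * (if (k - i) * k < 0 then q else 1) * (z * w (k - i)))"
    if "k > 0" for k
  proof -
    have "w k = z * (\<Sum>i=-int c..int d. p i * (if (k - i) * k < 0 then q else 1) * w (k - i))"
      using w[of k] that by simp
    then show ?thesis using that
      by (simp add: sum_distrib_left flip: sum_subtractf)
        (auto intro!: sum.cong simp: mult_less_0_iff mult_ac)
  qed
  have source': "w (- k) - z * (\<Sum>i=-int d..int c. p (- i) * (if k - i > 0 then w (- (k - i)) else 0)) =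
      (\<Sum>i=-int d..int c. if k - i > 0 then 0 else p (- i) * (if (k - i) * k < 0 then q else 1) * (z * w (- (k - i))))"
    if "k > 0" for k
  proof -
    have "(\<Sum>i=-int c..int d. p i * (if (- k - i) * - k < 0 then q else 1) * w (- k - i)) =
      (\<Sum>i=-int d..int c. p (- i) * (if (k - i) * k < 0 then q else 1) * w (- (k - i)))"
    proof (rule sum.reindex_bij_witness[of _ uminus uminus], goal_cases)
      case (5 a)
      have "- (k - - a) = - k - a" "(k - - a) * k = (- k - a) * - k" by (simp_all add: algebra_simps)
      then show ?case by (simp only: minus_minus)
    qed auto
    then have "w (- k) = z * (\<Sum>i=-int d..int c. p (- i) * (if (k - i) * k < 0 then q else 1) * w (- (k - i)))"
      using w[of "- k"] that by simp
    then show ?thesis using that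
      by (simp add: sum_distrib_left flip: sum_subtractf)
        (auto intro!: sum.cong simp: mult_less_0_iff mult_ac)
  qed
  have pos: "w k \<in> N" if "k > 0" for k
  proof (rule half_line[OF p z R N _ _ that])
    fix k :: int assume "k > 0"
    show "w k - z * (\<Sum>i=-int c..int d. p i * (if k - i > 0 then w (k - i) else 0)) \<in> N"
      unfolding source[OF \<open>k > 0\<close>]
      by (rule submodule_sum[OF N], rule step_N) (use \<open>k > 0\<close> in auto)
  next
    fix k assume "k > int d"
    then show "w k - z * (\<Sum>i=-int c..int d. p i * (if k - i > 0 then w (k - i) else 0)) = 0"
      by (subst source) (auto intro!: sum.neutral)
  qed
  have neg: "w (- k) \<in> N" if "k > 0" for k
  proof (rule half_line[where w = "\<lambda>k. w (- k)", OF p z R' N _ _ that])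
    fix k :: int assume "k > 0"
    show "w (- k) - z * (\<Sum>i=-int d..int c. p (- i) * (if k - i > 0 then w (- (k - i)) else 0)) \<in> N"
      unfolding source'[OF \<open>k > 0\<close>]
      by (rule submodule_sum[OF N], rule step_N) (use \<open>k > 0\<close> in auto)
  next
    fix k assume "k > int c"
    then show "w (- k) - z * (\<Sum>i=-int d..int c. p (- i) * (if k - i > 0 then w (- (k - i)) else 0)) = 0"
      by (subst source') (auto intro!: sum.neutral)
  qed
  have "w 0 - 1 = (\<Sum>i=-int c..int d. p i * (z * w (- i)))"
    by (subst w) (simp add: sum_distrib_left mult_ac)
  also have "\<dots> \<in> N"
    by (intro submodule_sum[OF N] submoduleD(3)[OF N p z_w]) auto
  finally have null: "w 0 - 1 \<in> N" .
  fix k :: int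
  show "\<exists>e\<in>A. w k - e \<in> N"
  proof (cases "k = 0")
    case True
    then show ?thesis using null one by blast
  next
    case False
    then have "w k \<in> N" using pos[of k] neg[of "- k"] by (cases "k > 0") auto
    then show ?thesis using zero by (intro bexI[of _ 0]) auto
  qed
qed simp

end

section \<open>Recurrence and functional equation for walks\<close>

lemma const_uq_simps [simp]:
  "const_uq 0 = 0" "const_uq 1 = 1"
  "const_uq (a + b) = const_uq a + const_uq b" "const_uq (a * b) = const_uq a * const_uq b"
  "const_uq (a - b) = const_uq a - const_uq b" "const_uq (- a) = - const_uq a"
proof -
  show "const_uq 1 = 1" by (simp add: const_uq_def flip: one_pCons)
qed (simp_all add: const_uq_def flip: to_fract_add to_fract_mult to_fract_diff to_fract_uminus)

lemma const_uq_sum: "const_uq (sum f A) = (\<Sum>x\<in>A. const_uq (f x))"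
  by (induction A rule: infinite_finite_induct) simp_all

text \<open>The contribution of a step from \<open>a\<close> to \<open>b\<close> to the power of \<open>q\<close>. The first step of a walk starts at
  altitude 0 and so contributes 1.\<close>

definition step_mark :: "int \<Rightarrow> int \<Rightarrow> 'a::field ratfun_uq" where
  "step_mark a b = (if a * b < 0 then var_q else 1)"

text \<open>This is the coefficient of \<open>z ^ n * u ^ k\<close> in the generating function, a polynomial in \<open>q\<close>.\<close>

definition walks_to :: "(int \<Rightarrow> 'a::field) \<Rightarrow> nat \<Rightarrow> nat \<Rightarrow> nat \<Rightarrow> int \<Rightarrow> 'a ratfun_uq" where
  "walks_to p c d n k = (\<Sum>j\<le>n. const_uq (num_walks p c d n k j) * var_q ^ j)"

lemma walks_to_eq_sum:
  "walks_to p c d n k = (\<Sum>y | y \<in> walks c d n \<and> y ! n = k.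
     const_uq (walk_weight p n y) * var_q ^ crossings n y)"
proof -
  have le: "crossings n y \<le> n" for y
  proof -
    have "crossings n y \<le> card {..<n}" unfolding crossings_def by (rule card_mono) auto
    then show ?thesis by simp
  qed
  have fin: "finite {y \<in> walks c d n. y ! n = k}" using finite_walks by simp
  have "walks_to p c d n k = (\<Sum>j\<le>n. \<Sum>y | y \<in> {y \<in> walks c d n. y ! n = k} \<and> crossings n y = j.
      const_uq (walk_weight p n y) * var_q ^ crossings n y)"
    unfolding walks_to_def num_walks_def const_uq_sum sum_distrib_right
    by (intro sum.cong refl) auto
  also have "\<dots> = (\<Sum>y | y \<in> walks c d n \<and> y ! n = k.
     const_uq (walk_weight p n y) * var_q ^ crossings n y)"
    by (rule sum.group[OF fin]) (use le in auto)
  finally show ?thesis .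
qed

lemma walks_to_0: "walks_to p c d 0 k = (if k = 0 then 1 else 0)"
proof -
  have "{y \<in> walks c d 0. y ! 0 = k} = (if k = 0 then {[0]} else {})"
    by (auto simp: walks_def length_Suc_conv)
  then show ?thesis by (simp add: walks_to_eq_sum walk_weight_def crossings_def)
qed

lemma walk_weight_snoc:
  assumes "length y = n + 1"
  shows "walk_weight p (Suc n) (y @ [k]) = p (k - y ! n) * walk_weight p n y"
  using assms by (simp add: walk_weight_def nth_append mult.commute)

lemma crossings_snoc:
  assumes "length y = n + 1" "y ! 0 = 0"
  shows "crossings (Suc n) (y @ [k]) = crossings n y + (if y ! n * k < 0 then 1 else 0)"
proof -
  let ?C = "\<lambda>n y. {t. 0 < t \<and> t < n \<and>
     (y ! t > 0 \<and> y ! (t + 1) < 0 \<or> y ! t < (0::int) \<and> y ! (t + 1) > 0)}"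
  have "?C (Suc n) (y @ [k]) = ?C n y \<union> (if y ! n * k < 0 then {n} else {})"
    using assms by (auto simp: nth_append less_Suc_eq mult_less_0_iff intro!: gr0I)
  moreover have "finite (?C n y)" by simp
  ultimately show ?thesis by (simp add: crossings_def)
qed

text \<open>Cutting off the last step is a bijection onto the pairs of a shorter walk and a jump.\<close>

lemma walks_to_Suc:
  "walks_to p c d (Suc n) k =
     (\<Sum>i=-int c..int d. const_uq (p i) * step_mark (k - i) k * walks_to p c d n (k - i))"
proof -
  let ?f = "\<lambda>n y. const_uq (walk_weight p n y) * var_q ^ crossings n y"
  let ?S = "SIGMA i:{-int c..int d}. {y. y \<in> walks c d n \<and> y ! n = k - i}"
  have "(\<Sum>i=-int c..int d. const_uq (p i) * step_mark (k - i) k * walks_to p c d n (k - i)) =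
      (\<Sum>i=-int c..int d. \<Sum>y | y \<in> walks c d n \<and> y ! n = k - i.
        const_uq (p i) * step_mark (k - i) k * ?f n y)"
    by (simp add: walks_to_eq_sum sum_distrib_left)
  also have "\<dots> = (\<Sum>(i, y)\<in>?S. const_uq (p i) * step_mark (k - i) k * ?f n y)"
    by (rule sum.Sigma) (use finite_walks in auto)
  also have "\<dots> = (\<Sum>y | y \<in> walks c d (Suc n) \<and> y ! Suc n = k. ?f (Suc n) y)"
  proof (rule sum.reindex_bij_witness[of _ "\<lambda>y. (k - y ! n, take (Suc n) y)" "\<lambda>(i, y). y @ [k]"],
      goal_cases)
    case (1 x)
    then show ?case by (auto simp: walks_def nth_append)
  next
    case (2 x)
    then show ?case by (auto simp: walks_def nth_append less_Suc_eq)
  next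
    case (3 y)
    then have "length y = Suc (Suc n)" "y ! Suc n = k" by (simp_all add: walks_def)
    then show ?case using take_Suc_conv_app_nth[of "Suc n" y] by simp
  next
    case (4 y)
    then show ?case by (auto simp: walks_def)
  next
    case (5 x)
    then show ?case
      by (auto simp: walks_def walk_weight_snoc crossings_snoc step_mark_def mult_ac)
  qed
  finally show ?thesis by (simp add: walks_to_eq_sum[of p c d "Suc n" k])
qed

lemma walks_to_outside:
  "k \<notin> {- int (n * c)..int (n * d)} \<Longrightarrow> walks_to p c d n k = 0"
proof (induction n arbitrary: k)
  case (Suc n)
  have "walks_to p c d n (k - i) = 0" if "i \<in> {-int c..int d}" for i
    using Suc.prems that by (intro Suc.IH) (auto simp: algebra_simps)
  then show ?case by (simp add: walks_to_Suc)
qed (simp add: walks_to_0)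

definition walks_to_gf :: "(int \<Rightarrow> 'a::field) \<Rightarrow> nat \<Rightarrow> nat \<Rightarrow> int \<Rightarrow> 'a ratfun_uq fps" where
  "walks_to_gf p c d k = Abs_fps (\<lambda>n. walks_to p c d n k)"

lemma walks_to_gf_rec:
  "walks_to_gf p c d k = (if k = 0 then 1 else 0) + fps_X *
     (\<Sum>i=-int c..int d. fps_const (const_uq (p i) * step_mark (k - i) k) * walks_to_gf p c d (k - i))"
  (is "?l = ?r")
proof (rule fps_ext)
  fix n
  show "fps_nth ?l n = fps_nth ?r n"
    by (cases n) (simp_all add: walks_to_gf_def walks_to_0 walks_to_Suc fps_sum_nth)
qed

lemma walk_gf_nth:
  "fps_nth (walk_gf p c d) n = (\<Sum>k=-int (n*c)..int (n*d). walks_to p c d n k * var_u powi k)"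
  unfolding walk_gf_def walks_to_def
  by (simp add: sum_distrib_left sum_distrib_right mult_ac)

lemma var_u_nonzero [simp]: "var_u \<noteq> 0"
  by (simp add: var_u_def)

text \<open>Without marking the crossings, appending a step multiplies the generating function by \<open>z * P(u)\<close>.
  The correction for a step of height \<open>i\<close> from \<open>k\<close> is \<open>(q - 1)\<close> times its weight if the step crosses
  the axis, and 0 otherwise. Crossing steps start within a jump of the axis, so the correction
  involves only finitely many of the series \<open>walks_to_gf p c d k\<close>, and this turns the problem for the
  bilateral series into one for these.\<close>

lemma walk_gf_functional_equation:
  fixes p :: "int \<Rightarrow> 'a::field"
  shows "walk_gf p c d *
      (1 - fps_X * (\<Sum>i=-int c..int d. fps_const (const_uq (p i) * var_u powi i))) =
    1 + fps_X * (\<Sum>i=-int c..int d. \<Sum>k=-int d..int c.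
      fps_const ((step_mark k (k + i) - 1) * const_uq (p i) * var_u powi (k + i)) *
      walks_to_gf p c d k)"
    (is "?W * (1 - fps_X * ?P) = 1 + fps_X * ?C")
proof -
  have "?W = 1 + fps_X * (?P * ?W + ?C)"
  proof (rule fps_ext)
    fix n
    show "fps_nth ?W n = fps_nth (1 + fps_X * (?P * ?W + ?C)) n"
    proof (cases n)
      case 0
      then show ?thesis by (simp add: walk_gf_nth walks_to_0)
    next
      case (Suc n')
      let ?L = "{- int (n' * c)..int (n' * d)}"
      let ?w = "walks_to p c d n'"
      let ?t = "\<lambda>i k. const_uq (p i) * var_u powi (k + i) * ?w k"
      have "fps_nth ?W n = (\<Sum>k=-int (n*c)..int (n*d). \<Sum>i=-int c..int d.
          step_mark (k - i) k * (const_uq (p i) * var_u powi k * ?w (k - i)))"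
        by (simp add: walk_gf_nth Suc walks_to_Suc sum_distrib_left sum_distrib_right mult_ac)
      also have "\<dots> = (\<Sum>i=-int c..int d. \<Sum>k=-int (n*c)..int (n*d).
          step_mark (k - i) k * (const_uq (p i) * var_u powi k * ?w (k - i)))"
        by (rule sum.swap)
      also have "\<dots> = (\<Sum>i=-int c..int d. \<Sum>k\<in>?L. step_mark k (k + i) * ?t i k)"
      proof (rule sum.cong[OF refl])
        fix i assume i: "i \<in> {-int c..int d}"
        have "(\<Sum>k=-int (n*c)..int (n*d). step_mark (k - i) k * (const_uq (p i) * var_u powi k * ?w (k - i)))
          = (\<Sum>k\<in>(\<lambda>k. k + i) ` ?L. step_mark (k - i) k * (const_uq (p i) * var_u powi k * ?w (k - i)))"
        proof (rule sum.mono_neutral_right)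
          show "(\<lambda>k. k + i) ` ?L \<subseteq> {-int (n*c)..int (n*d)}"
            using i by (auto simp: Suc algebra_simps)
          show "\<forall>k\<in>{-int (n*c)..int (n*d)} - (\<lambda>k. k + i) ` ?L.
              step_mark (k - i) k * (const_uq (p i) * var_u powi k * ?w (k - i)) = 0"
          proof
            fix k assume "k \<in> {-int (n*c)..int (n*d)} - (\<lambda>k. k + i) ` ?L"
            then have "k - i \<notin> ?L" by (auto simp: image_iff)
            then have "?w (k - i) = 0" by (rule walks_to_outside)
            then show "step_mark (k - i) k * (const_uq (p i) * var_u powi k * ?w (k - i)) = 0"
              by simp
          qed
        qed simp
        also have "\<dots> = (\<Sum>k\<in>?L. step_mark k (k + i) * ?t i k)"
          by (subst sum.reindex) (simp_all add: inj_on_def)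
        finally show "(\<Sum>k=-int (n*c)..int (n*d). step_mark (k - i) k * (const_uq (p i) * var_u powi k * ?w (k - i)))
          = (\<Sum>k\<in>?L. step_mark k (k + i) * ?t i k)" .
      qed
      also have "\<dots> = (\<Sum>i=-int c..int d. \<Sum>k\<in>?L. ?t i k) +
          (\<Sum>i=-int c..int d. \<Sum>k\<in>?L. (step_mark k (k + i) - 1) * ?t i k)"
        by (simp add: algebra_simps flip: sum.distrib)
      also have "(\<Sum>i=-int c..int d. \<Sum>k\<in>?L. ?t i k) = fps_nth (?P * ?W) n'"
        by (simp add: sum_distrib_right sum_distrib_left fps_sum_nth walk_gf_nth power_int_add mult_ac)
      also have "(\<Sum>i=-int c..int d. \<Sum>k\<in>?L. (step_mark k (k + i) - 1) * ?t i k) = fps_nth ?C n'"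
      proof -
        have "(\<Sum>k\<in>?L. (step_mark k (k + i) - 1) * ?t i k) =
            (\<Sum>k=-int d..int c. (step_mark k (k + i) - 1) * ?t i k)"
          if i: "i \<in> {-int c..int d}" for i
        proof (rule sum.mono_neutral_cong)
          \<comment> \<open>The two ranges of altitudes differ only by altitudes that no walk of this length
            reaches, and by altitudes that are too far from the axis for a crossing.\<close>
          show "(step_mark k (k + i) - 1) * ?t i k = 0" if "k \<in> {-int d..int c} - ?L" for k
            using that walks_to_outside[of k n' c d p] by auto
          show "(step_mark k (k + i) - 1) * ?t i k = 0" if "k \<in> ?L - {-int d..int c}" for k
          proof -
            have "\<not> k * (k + i) < 0" using i that by (auto simp: mult_less_0_iff)
            then show ?thesis by (simp add: step_mark_def)
          qed
        qed auto
        then show ?thesis by (simp add: fps_sum_nth walks_to_gf_def mult_ac)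
      qed
      finally show ?thesis by (simp add: Suc)
    qed
  qed
  then show ?thesis by (simp add: algebra_simps)
qed

section \<open>Extending the constants from K to K(u,q)\<close>

lemma fls_nth_lift_fls [simp]: "fls_nth (lift_fls f) n = const_uq (fls_nth f n)"
  unfolding lift_fls_def
  by (rule nth_Abs_fls_ex_lower_bound) (auto intro!: exI[of _ "fls_subdegree f"] simp: fls_eq0_below_subdegree)

lemma const_uq_eq_0_iff [simp]: "const_uq a = 0 \<longleftrightarrow> a = 0"
  by (simp add: const_uq_def)

lemma const_uq_eq_iff [simp]: "const_uq a = const_uq b \<longleftrightarrow> a = b"
  by (simp add: const_uq_def)

lemma lift_fls_1: "lift_fls 1 = 1"
  by (rule fls_eqI) simp

lemma lift_fls_mult: "lift_fls (f * g) = lift_fls f * lift_fls g"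
proof -
  have sub: "fls_subdegree (lift_fls f) = fls_subdegree f" for f :: "'a fls"
  proof (cases "f = 0")
    case True
    then have "lift_fls f = 0" by (intro fls_eqI) simp
    then show ?thesis using True by simp
  next
    case False
    then show ?thesis by (intro fls_subdegree_eqI) (simp_all add: fls_eq0_below_subdegree)
  qed
  show ?thesis by (rule fls_eqI) (simp add: fls_times_nth(2) sub const_uq_sum)
qed

definition lift_fps :: "'a::field fps \<Rightarrow> 'a ratfun_uq fps" where
  "lift_fps f = Abs_fps (\<lambda>n. const_uq (fps_nth f n))"

lemma lift_fls_fps_to_fls: "lift_fls (fps_to_fls f) = fps_to_fls (lift_fps f)"
  by (rule fls_eqI) (simp add: lift_fps_def)

lemma lift_fls_inverse:
  fixes f :: "'a::field fls"
  shows "lift_fls (inverse f) = inverse (lift_fls f)"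
proof (cases "f = 0")
  case True
  have "lift_fls (0 :: 'a fls) = 0" by (rule fls_eqI) simp
  then show ?thesis using True by simp
next
  case False
  then have "lift_fls f * lift_fls (inverse f) = 1" by (simp add: lift_fls_1 flip: lift_fls_mult)
  then show ?thesis by (metis inverse_unique)
qed

lemma lift_fps_hom:
  "lift_fps 0 = 0" "lift_fps 1 = 1" "lift_fps (f - g) = lift_fps f - lift_fps g"
  "lift_fps (f * g) = lift_fps f * lift_fps g"
  by (rule fps_ext; simp add: lift_fps_def fps_mult_nth const_uq_sum)+

lemma poly_kernel_poly_lift_fps:
  "poly (kernel_poly (\<lambda>i. fps_const (const_uq (p i))) c d (fps_X ^ m)) (lift_fps r) =
    lift_fps (poly (kernel_poly (\<lambda>i. fps_const (p i)) c d (fps_X ^ m)) r)"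
proof -
  have "lift_fps (fps_const a) = fps_const (const_uq a)" for a :: 'a
    by (rule fps_ext) (simp add: lift_fps_def)
  moreover have "lift_fps (fps_X ^ m :: 'a fps) = fps_X ^ m"
    by (rule fps_ext) (simp add: lift_fps_def fps_X_power_nth)
  ultimately show ?thesis
    using poly_kernel_poly_hom[OF lift_fps_hom(2-4), of "\<lambda>i. fps_const (p i)" c d "fps_X ^ m" r] by simp
qed

section \<open>The generating function\<close>

lemma field_zuq_compose_power:
  assumes "m > 0" "x \<in> field_zuq m {}"
  shows "\<exists>y\<in>field_zuq 1 {}. fls_compose_power y m = x"
  using assms(2) unfolding field_zuq_def
proof (induction rule: generated_subfield.induct)
  case (base x)
  have X: "fls_compose_power (fls_X ^ 1) m = (fls_X ^ m :: 'a ratfun_uq fls)"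
    using assms(1) by (simp add: fls_X_power_conv_shift_1)
  have C: "fls_compose_power (fls_const a) m = fls_const a" for a :: "'a ratfun_uq"
    using assms(1) by simp
  from base consider a where "x = fls_const (const_uq a)" | "x = fls_X ^ m"
    | "x = fls_const var_u" | "x = fls_const var_q" by auto
  then show ?case
    by cases (use X C in \<open>auto intro!: bexI generated_subfield.base\<close>)
next
  case one
  then show ?case using assms(1) by (intro bexI[of _ 1] generated_subfield.one) simp
next
  case (diff x y)
  then obtain x' y' where "x' \<in> field_zuq 1 {}" "fls_compose_power x' m = x"
    "y' \<in> field_zuq 1 {}" "fls_compose_power y' m = y" by (auto simp: field_zuq_def)
  then show ?case
    by (intro bexI[of _ "x' - y'"]) (auto simp: field_zuq_def intro: generated_subfield.diff)
next
  case (mult x y)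
  then obtain x' y' where "x' \<in> field_zuq 1 {}" "fls_compose_power x' m = x"
    "y' \<in> field_zuq 1 {}" "fls_compose_power y' m = y" by (auto simp: field_zuq_def)
  then show ?case
    by (intro bexI[of _ "x' * y'"]) (auto simp: field_zuq_def intro: generated_subfield.mult)
next
  case (inverse x)
  then obtain y where y: "y \<in> field_zuq 1 {}" "fls_compose_power y m = x" by (auto simp: field_zuq_def)
  have "fls_compose_power (inverse y) m = inverse x"
  proof (cases "y = 0")
    case False
    then have "fls_compose_power (y * inverse y) m = 1" using assms(1) by simp
    then have "x * fls_compose_power (inverse y) m = 1" by (simp only: fls_compose_power_mult y(2))
    then show ?thesis by (metis inverse_unique)
  qed (use y in simp)
  then show ?case using y(1) by (intro bexI[of _ "inverse y"])
    (auto simp: field_zuq_def intro: generated_subfield.inverse)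
qed

lemma fls_compose_power_eq_0_iff:
  assumes "m > 0"
  shows "fls_compose_power f m = 0 \<longleftrightarrow> f = 0"
proof
  assume *: "fls_compose_power f m = 0"
  show "f = 0"
  proof (rule fls_eqI)
    fix n
    have "fls_nth (fls_compose_power f m) (int m * n) = fls_nth f n"
      using assms by (simp add: fls_nth_compose_power)
    then show "fls_nth f n = fls_nth 0 n" using * by simp
  qed
qed simp

text \<open>Substituting \<open>t ^ m\<close> for \<open>z\<close> is an injective ring homomorphism that maps \<open>K(z,u,q)\<close> onto the field
  \<open>K(t^m,u,q)\<close>, so an algebraic relation over the latter can be pulled back coefficient by
  coefficient.\<close>

lemma algebraic_over_compose_power:
  assumes m: "m > 0" and alg: "algebraic_over (field_zuq m {}) (fls_compose_power f m)"
  shows "algebraic_over (field_zuq 1 {}) f"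
proof -
  let ?h = "\<lambda>f. fls_compose_power f m"
  obtain Q where Q: "Q \<noteq> 0" "\<And>i. Polynomial.coeff Q i \<in> field_zuq m {}" "poly Q (?h f) = 0"
    using alg by (auto simp: algebraic_over_def)
  then have "\<forall>i. \<exists>y\<in>field_zuq 1 {}. ?h y = Polynomial.coeff Q i"
    using field_zuq_compose_power[OF m] by blast
  then obtain g where g: "\<And>i. g i \<in> field_zuq 1 {}" "\<And>i. ?h (g i) = Polynomial.coeff Q i"
    by metis
  define Q' where "Q' = (\<Sum>i\<le>Polynomial.degree Q. Polynomial.monom (g i) i)"
  have coeff: "Polynomial.coeff Q' i = (if i \<le> Polynomial.degree Q then g i else 0)" for i
    by (simp add: Q'_def coeff_sum)
  have sum: "?h (sum F I) = (\<Sum>i\<in>I. ?h (F i))" for F and I :: "nat set"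
    by (induction I rule: infinite_finite_induct) simp_all
  have "?h (poly Q' f) = poly Q (?h f)"
    using m by (simp add: Q'_def poly_sum poly_monom sum g poly_altdef[of Q])
  then have "poly Q' f = 0" by (simp add: Q(3) fls_compose_power_eq_0_iff[OF m])
  moreover have "Q' \<noteq> 0"
  proof
    assume "Q' = 0"
    then have "g (Polynomial.degree Q) = 0" using coeff[of "Polynomial.degree Q"] by simp
    then have "Polynomial.coeff Q (Polynomial.degree Q) = 0" using g(2)[of "Polynomial.degree Q"] by simp
    then show False using Q(1) by simp
  qed
  moreover have "Polynomial.coeff Q' i \<in> field_zuq 1 {}" for i
    using g(1) by (simp add: coeff) (simp add: field_zuq_def generated_subfield_zero)
  ultimately show ?thesis unfolding algebraic_over_def by blast
qed

lemma kernel_poly_root_algebraic: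
  fixes p :: "int \<Rightarrow> 'a::field"
  assumes "m > 0"
    and "poly (kernel_poly (\<lambda>i. fls_const (const_uq (p i))) c d (fls_X ^ m)) r = 0"
  shows "algebraic_over (field_zuq m {}) r"
proof -
  have "Polynomial.coeff (kernel_poly (\<lambda>i. fls_const (const_uq (p i))) c d (fls_X ^ m)) n
      \<in> field_zuq m {}" for n
  proof -
    have "fls_X ^ m * fls_const (const_uq (p i)) \<in> field_zuq m {}" for i
      unfolding field_zuq_def by (intro generated_subfield.mult generated_subfield.base) auto
    moreover have "(if n = c then 1 else 0) \<in> field_zuq m ({} :: 'a ratfun_uq fls set)"
      "0 \<in> field_zuq m ({} :: 'a ratfun_uq fls set)"
      by (simp_all add: field_zuq_def generated_subfield.one generated_subfield_zero)
    ultimately show ?thesis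
      unfolding coeff_kernel_poly field_zuq_def
      by (intro generated_subfield.diff) (simp_all only: split: if_split, simp)
  qed
  then show ?thesis
    unfolding algebraic_over_def
    by (intro exI[of _ "kernel_poly (\<lambda>i. fls_const (const_uq (p i))) c d (fls_X ^ m)"])
      (simp add: assms(2) kernel_poly_nonzero[OF assms(1)])
qed

lemma series_subring_generated:
  "series_subring {x :: 'b::field fps. fps_to_fls x \<in> generated_subfield S}"
proof
  fix x :: "'b fps"
  assume "x \<in> {x. fps_to_fls x \<in> generated_subfield S}" "fps_nth x 0 \<noteq> 0"
  then show "inverse x \<in> {x. fps_to_fls x \<in> generated_subfield S}"
    using generated_subfield.inverse[of "fps_to_fls x" S]
    by (simp add: fls_inverse_fps_to_fls subdegree_eq_0_iff)
qed (simp_all add: fls_times_fps_to_fls generated_subfield.one generated_subfield.diff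
      generated_subfield.mult)

text \<open>The series \<open>walks_to_gf\<close> for altitudes in \<open>{-d..c}\<close> lie in the field by
  \<open>boundary_series_in_subring\<close>; the functional equation expresses the whole generating function by
  them, as \<open>1 - z * P(u)\<close> is invertible.\<close>

theorem walk_gf_in_field:
  fixes p :: "int \<Rightarrow> 'a::field"
  assumes m: "m > 0"
    and R: "finite R" "card R = c" "\<And>r. r \<in> R \<Longrightarrow> fps_nth r 0 = 0"
      "\<And>r. r \<in> R \<Longrightarrow> poly (kernel_poly (\<lambda>i. fps_const (p i)) c d (fps_X ^ m)) r = 0"
    and R': "finite R'" "card R' = d" "\<And>r. r \<in> R' \<Longrightarrow> fps_nth r 0 = 0"
      "\<And>r. r \<in> R' \<Longrightarrow> poly (kernel_poly (\<lambda>i. fps_const (p (- i))) d c (fps_X ^ m)) r = 0"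
    and S: "\<And>r. r \<in> R \<union> R' \<Longrightarrow> fps_to_fls (lift_fps r) \<in> field_zuq m S"
  shows "fls_compose_power (fps_to_fls (walk_gf p c d)) m \<in> field_zuq m S"
proof -
  define A where "A = {x. fps_to_fls x \<in> field_zuq m S}"
  interpret series_subring A
    unfolding A_def field_zuq_def by (rule series_subring_generated)
  have X: "fps_X ^ m \<in> A"
    by (simp add: A_def fps_to_fls_power field_zuq_def generated_subfield.base)
  have q: "fps_const var_q \<in> A" and u: "fls_const var_u \<in> field_zuq m S"
    by (simp_all add: A_def field_zuq_def generated_subfield.base)
  have const: "fps_const (const_uq a) \<in> A" for a
    by (simp add: A_def field_zuq_def generated_subfield.base)
  have u_int: "fps_const (var_u powi k) \<in> A" for k
    using u generated_subfield_power_int by (simp add: A_def field_zuq_def fls_const_power_int)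
  have mark: "fps_const (step_mark a b) \<in> A" for a b
    using q one by (simp add: step_mark_def)
  define w where "w k = walks_to_gf p c d k oo fps_X ^ m" for k
  have X0: "fps_nth (fps_X ^ m :: 'a ratfun_uq fps) 0 = 0" using m by simp
  note comp = fps_compose_add_distrib fps_compose_mult_distrib[OF X0] fps_compose_sum_distrib
    fps_compose_sub_distrib
  have w_rec: "w k = (if k = 0 then 1 else 0) + fps_X ^ m * (\<Sum>i=-int c..int d.
      fps_const (const_uq (p i)) * (if (k - i) * k < 0 then fps_const var_q else 1) * w (k - i))" for k
  proof -
    have "w k = ((if k = 0 then 1 else 0) + fps_X * (\<Sum>i=-int c..int d.
        fps_const (const_uq (p i) * step_mark (k - i) k) * walks_to_gf p c d (k - i))) oo fps_X ^ m"
      unfolding w_def by (subst walks_to_gf_rec) (rule refl)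
    also have "\<dots> = (if k = 0 then 1 else 0) + fps_X ^ m * (\<Sum>i=-int c..int d.
        fps_const (const_uq (p i) * step_mark (k - i) k) * w (k - i))"
      using m by (simp add: comp w_def)
    also have "(\<Sum>i=-int c..int d. fps_const (const_uq (p i) * step_mark (k - i) k) * w (k - i)) =
      (\<Sum>i=-int c..int d. fps_const (const_uq (p i)) *
        (if (k - i) * k < 0 then fps_const var_q else 1) * w (k - i))"
      by (intro sum.cong refl) (simp add: step_mark_def)
    finally show ?thesis .
  qed
  have lift_inj: "inj_on lift_fps M" for M :: "'a fps set"
    by (rule inj_onI) (simp add: lift_fps_def fps_eq_iff)
  have w: "w k \<in> A" if "k \<in> {-int d..int c}" for k
  proof (rule boundary_series_in_subring[where p = "\<lambda>i. fps_const (const_uq (p i))"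
        and z = "fps_X ^ m" and q = "fps_const var_q" and R = "lift_fps ` R" and R' = "lift_fps ` R'", OF const X X0 q _ _ _ _ _ _ _ _ _ _ w_rec that])
    show "card (lift_fps ` R) = c" "card (lift_fps ` R') = d"
      by (simp_all add: card_image lift_inj R R')
    show "lift_fps ` R \<subseteq> A" "lift_fps ` R' \<subseteq> A" using S by (auto simp: A_def)
    show "finite (lift_fps ` R)" "finite (lift_fps ` R')" using R(1) R'(1) by simp_all
    show "fps_nth r 0 = 0" if "r \<in> lift_fps ` R" for r
      using that R(3) by (auto simp: lift_fps_def)
    show "fps_nth r 0 = 0" if "r \<in> lift_fps ` R'" for r
      using that R'(3) by (auto simp: lift_fps_def)
    show "poly (kernel_poly (\<lambda>i. fps_const (const_uq (p i))) c d (fps_X ^ m)) r = 0"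
      if "r \<in> lift_fps ` R" for r
      using that by (auto simp only: poly_kernel_poly_lift_fps R(4) lift_fps_hom(1))
    show "poly (kernel_poly (\<lambda>i. fps_const (const_uq (p (- i)))) d c (fps_X ^ m)) r = 0"
      if "r \<in> lift_fps ` R'" for r
      using that by (auto simp only: poly_kernel_poly_lift_fps R'(4) lift_fps_hom(1))
  qed
  define P where "P = (\<Sum>i=-int c..int d. fps_const (const_uq (p i) * var_u powi i))"
  define C where "C = (\<Sum>i=-int c..int d. \<Sum>k=-int d..int c.
      fps_const ((step_mark k (k + i) - 1) * const_uq (p i) * var_u powi (k + i)) * w k)"
  have "fps_const ((step_mark a b - 1) * const_uq x * var_u powi l) =
      (fps_const (step_mark a b) - 1) * fps_const (const_uq x) * fps_const (var_u powi l)"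
    for a b l and x :: 'a by (simp flip: fps_const_1_eq_1)
  then have coeff: "fps_const ((step_mark a b - 1) * const_uq x * var_u powi l) \<in> A" for a b l x
    by (simp only: mult diff mark const u_int one)
  have "C \<in> A" unfolding C_def
    by (intro submodule_sum[OF submodule_self] mult coeff w)
  have "fps_const (const_uq x * var_u powi l) \<in> A" for x l
    using mult[OF const u_int] by simp
  then have "P \<in> A" unfolding P_def by (intro submodule_sum[OF submodule_self])
  have eq: "(walk_gf p c d oo fps_X ^ m) * (1 - fps_X ^ m * P) = 1 + fps_X ^ m * C"
    using arg_cong[OF walk_gf_functional_equation[of p c d], of "\<lambda>f. f oo fps_X ^ m"] m
    by (simp add: comp P_def C_def w_def)
  have unit: "(1 - fps_X ^ m * P) * inverse (1 - fps_X ^ m * P) = 1"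
    by (rule inverse_mult_eq_1') (use m in simp)
  have "walk_gf p c d oo fps_X ^ m =
      (walk_gf p c d oo fps_X ^ m) * ((1 - fps_X ^ m * P) * inverse (1 - fps_X ^ m * P))"
    by (simp only: unit mult_1_right)
  also have "\<dots> = (1 + fps_X ^ m * C) * inverse (1 - fps_X ^ m * P)"
    by (simp only: eq flip: mult.assoc)
  also have "\<dots> \<in> A"
    using \<open>C \<in> A\<close> \<open>P \<in> A\<close> X m by (intro mult add inverse diff one) auto
  finally show ?thesis using m by (simp add: A_def fls_compose_power_fps_to_fls)
qed

theorem theorem2p1:
  fixes p :: "int \<Rightarrow> 'a::{alg_closed_field, field_char_0}" and c d :: nat
  assumes "c > 0 \<Longrightarrow> p (- int c) \<noteq> 0" and "d > 0 \<Longrightarrow> p (int d) \<noteq> 0"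
  shows "algebraic_over (field_zuq 1 {}) (fps_to_fls (walk_gf p c d)) \<and>
    (\<exists>m>0. card (small_roots p c d m) = c \<and> card (large_roots p c d m) = d \<and>
       kernel_roots p c d m = small_roots p c d m \<union> large_roots p c d m \<and>
       fls_compose_power (fps_to_fls (walk_gf p c d)) m
         \<in> field_zuq m (lift_fls ` kernel_roots p c d m))"
proof -
  \<comment> \<open>Small roots are series in \<open>z ^ (1/c)\<close> and large roots in \<open>z ^ (1/d)\<close>; the maxima with 1 keep \<open>m\<close>
    positive when there are no small or no large roots.\<close>
  define m where "m = max 1 c * max 1 d"
  have m: "m > 0" "c > 0 \<Longrightarrow> c dvd m" "d > 0 \<Longrightarrow> d dvd m" by (auto simp: m_def max_def)
  have "\<exists>R R'. finite R \<and> card R = c \<and> (\<forall>r\<in>R. fps_nth r 0 = 0 \<and>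
        poly (kernel_poly (\<lambda>i. fps_const (p i)) c d (fps_X ^ m)) r = 0) \<and>
      finite R' \<and> card R' = d \<and> (\<forall>r\<in>R'. fps_nth r 0 = 0 \<and>
        poly (kernel_poly (\<lambda>i. fps_const (p (- i))) d c (fps_X ^ m)) r = 0) \<and>
      small_roots p c d m = fps_to_fls ` R \<and>
      large_roots p c d m = (\<lambda>r. inverse (fps_to_fls r)) ` R' \<and>
      kernel_roots p c d m = fps_to_fls ` R \<union> (\<lambda>r. inverse (fps_to_fls r)) ` R'"
    using assms m by (rule kernel_roots_structure)
  then obtain R R' where R: "finite R" "card R = c" "\<And>r. r \<in> R \<Longrightarrow> fps_nth r 0 = 0"
    "\<And>r. r \<in> R \<Longrightarrow> poly (kernel_poly (\<lambda>i. fps_const (p i)) c d (fps_X ^ m)) r = 0"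
    and R': "finite R'" "card R' = d" "\<And>r. r \<in> R' \<Longrightarrow> fps_nth r 0 = 0"
    "\<And>r. r \<in> R' \<Longrightarrow> poly (kernel_poly (\<lambda>i. fps_const (p (- i))) d c (fps_X ^ m)) r = 0"
    and roots: "small_roots p c d m = fps_to_fls ` R"
    "large_roots p c d m = (\<lambda>r. inverse (fps_to_fls r)) ` R'"
    "kernel_roots p c d m = fps_to_fls ` R \<union> (\<lambda>r. inverse (fps_to_fls r)) ` R'"
    by (elim exE conjE) (rule that; (assumption | simp))
  let ?F = "field_zuq m (lift_fls ` kernel_roots p c d m)"
  have lift: "fps_to_fls (lift_fps r) \<in> ?F" if "r \<in> R \<union> R'" for r
  proof (cases "r \<in> R")
    case True
    then have "lift_fls (fps_to_fls r) \<in> lift_fls ` kernel_roots p c d m" by (simp add: roots)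
    then show ?thesis by (auto simp: field_zuq_def lift_fls_fps_to_fls intro: generated_subfield.base)
  next
    case False
    then have "lift_fls (inverse (fps_to_fls r)) \<in> lift_fls ` kernel_roots p c d m"
      using that by (simp add: roots)
    then have "inverse (fps_to_fls (lift_fps r)) \<in> ?F"
      by (auto simp: field_zuq_def lift_fls_inverse lift_fls_fps_to_fls intro: generated_subfield.base)
    then have "inverse (inverse (fps_to_fls (lift_fps r))) \<in> ?F"
      unfolding field_zuq_def by (rule generated_subfield.inverse)
    then show ?thesis by simp
  qed
  have W: "fls_compose_power (fps_to_fls (walk_gf p c d)) m \<in> ?F"
    by (rule walk_gf_in_field[OF m(1) R R' lift])
  have lift_alg: "algebraic_over (field_zuq m {}) (lift_fls r)" if r: "r \<in> kernel_roots p c d m" for r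
  proof -
    consider s where "s \<in> R" "r = fps_to_fls s" | s where "s \<in> R'" "r = inverse (fps_to_fls s)"
      using r roots(3) by auto
    then show ?thesis
    proof cases
      case 1
      then show ?thesis
        using R(4) by (intro kernel_poly_root_algebraic[OF m(1), of p c d])
          (simp add: lift_fls_fps_to_fls poly_kernel_poly_fps_to_fls poly_kernel_poly_lift_fps lift_fps_hom(1))
    next
      case 2
      then have "algebraic_over (field_zuq m {}) (fps_to_fls (lift_fps s))"
        using R'(4) by (intro kernel_poly_root_algebraic[OF m(1), of "\<lambda>i. p (- i)" d c])
          (simp add: poly_kernel_poly_fps_to_fls poly_kernel_poly_lift_fps lift_fps_hom(1))
      then have "algebraic_over (field_zuq m {}) (inverse (fps_to_fls (lift_fps s)))"
        unfolding field_zuq_def by (intro algebraic_over_generated_closed(3))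
      then show ?thesis using 2 by (simp add: lift_fls_inverse lift_fls_fps_to_fls)
    qed
  qed
  have "algebraic_over (field_zuq m {}) (fls_compose_power (fps_to_fls (walk_gf p c d)) m)"
    using W unfolding field_zuq_def
  proof (rule generated_subfield_algebraic, elim UnE, goal_cases)
    case (3 x)
    then show ?case using lift_alg by (auto simp: field_zuq_def)
  qed (auto intro!: algebraic_over_self generated_subfield.base)
  then have "algebraic_over (field_zuq 1 {}) (fps_to_fls (walk_gf p c d))"
    by (rule algebraic_over_compose_power[OF m(1)])
  moreover have "card (small_roots p c d m) = c" "card (large_roots p c d m) = d"
    unfolding roots by (subst card_image, simp_all add: inj_on_def R R')+
  ultimately show ?thesis
    using m(1) W by (intro conjI exI[of _ m]) (simp_all only: roots)
qed

end
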